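(* Let $\varrho$ be a state on $\mathbb{C}^d$, let $\pi$ be a pure state of one qubit, and put $I(\varrho)=\log d-S(\varrho)$. Then the optimal asymptotic transition rates under noisy operations satisfy $$R(\varrho\to\pi)=I(\varrho),$$ and, if $\varrho$ is not maximally mixed, $$R(\pi\to\varrho)=\frac{1}{I(\varrho)}.$$
   Context: Logarithms are base $2$ and $S(\varrho)=-\mathrm{Tr}\,\varrho\log\varrho$ is the von Neumann entropy. A state on $\mathbb{C}^d$ is a positive semidefinite operator of trace $1$. The maximally mixed state on $\mathbb{C}^K$ is $\tau_K=\mathbb{1}/K$. Noisy operations (NO) are the maps on states obtained as finite compositions of the following: (1) unitary transformations; (2) adding an ancilla in a maximally mixed state, $\varrho\mapsto\varrho\otimes\tau_K$, for an arbitrary finite dimension $K$; (3) discarding a subsystem, i.e. taking the partial trace over a tensor factor of the Hilbert space (for any identification of the Hilbert space with a tensor product $\mathbb{C}^a\otimes\mathbb{C}^b$). Optimal rate: for states $\varrho,\sigma$ on finite-dimensional spaces, $R(\varrho\to\sigma)$ is the supremum of $\lim_{n\to\infty} m_n/n$ over all sequences of nonnegative integers $(m_n)$ for which this limit exists and for which there are noisy operations $\Lambda_n$, with output on the space of $\sigma^{\otimes m_n}$, such that $\|\Lambda_n(\varrho^{\otimes n})-\sigma^{\otimes m_n}\|\to0$ as $n\to\infty$ (trace norm). *)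

theory Defs
  imports
    "Jordan_Normal_Form.Schur_Decomposition"
    "HOL-Library.Extended_Real"
begin

definition mat_trace :: "complex mat \<Rightarrow> complex" where
  "mat_trace A = (\<Sum>i<dim_row A. A $$ (i, i))"

definition unitary_mat :: "nat \<Rightarrow> complex mat \<Rightarrow> bool" where
  "unitary_mat n U \<longleftrightarrow> U \<in> carrier_mat n n \<and>
     mat_adjoint U * U = 1\<^sub>m n \<and> U * mat_adjoint U = 1\<^sub>m n"

(* In (\<le>) on complex, 0 \<le> z means that z is real and nonnegative. *)
definition psd_mat :: "nat \<Rightarrow> complex mat \<Rightarrow> bool" where
  "psd_mat n A \<longleftrightarrow> A \<in> carrier_mat n n \<and> mat_adjoint A = A \<and>
     (\<forall>v \<in> carrier_vec n. 0 \<le> (A *\<^sub>v v) \<bullet>c v)"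

definition quantum_state :: "nat \<Rightarrow> complex mat \<Rightarrow> bool" where
  "quantum_state d \<rho> \<longleftrightarrow> psd_mat d \<rho> \<and> mat_trace \<rho> = 1"

definition pure_state :: "nat \<Rightarrow> complex mat \<Rightarrow> bool" where
  "pure_state d \<rho> \<longleftrightarrow> (\<exists>\<psi> \<in> carrier_vec d. \<psi> \<bullet>c \<psi> = 1 \<and>
     \<rho> = mat d d (\<lambda>(i, j). \<psi> $ i * conjugate (\<psi> $ j)))"

definition max_mixed :: "nat \<Rightarrow> complex mat" where
  "max_mixed K = (1 / of_nat K) \<cdot>\<^sub>m 1\<^sub>m K"

(* Functional calculus: apply f to the eigenvalues in a unitary diagonalisation.
   The value does not depend on the diagonalisation (mat_fun_eq below); one exists
   for every Hermitian A, and mat_fun f A is used only for such A. *)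
definition mat_fun :: "(real \<Rightarrow> real) \<Rightarrow> complex mat \<Rightarrow> complex mat" where
  "mat_fun f A = (THE B. \<exists>U l. unitary_mat (dim_row A) U \<and>
     A = U * mat_diag (dim_row A) (\<lambda>i. complex_of_real (l i)) * mat_adjoint U \<and>
     B = U * mat_diag (dim_row A) (\<lambda>i. complex_of_real (f (l i))) * mat_adjoint U)"

lemma mat_adjoint_carrier:
  "A \<in> carrier_mat n m \<Longrightarrow> mat_adjoint A \<in> carrier_mat m n"
  unfolding mat_adjoint_def by (intro carrier_matI) auto

lemma unitary_diag_fun_unique:
  assumes U: "unitary_mat n U" and V: "unitary_mat n V"
    and eq: "U * mat_diag n (\<lambda>i. complex_of_real (l i)) * mat_adjoint U =
             V * mat_diag n (\<lambda>i. complex_of_real (m i)) * mat_adjoint V"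
  shows "U * mat_diag n (\<lambda>i. complex_of_real (f (l i))) * mat_adjoint U =
         V * mat_diag n (\<lambda>i. complex_of_real (f (m i))) * mat_adjoint V"
proof -
  define W where "W = mat_adjoint V * U"
  have cU: "U \<in> carrier_mat n n" and cV: "V \<in> carrier_mat n n"
    using U V by (auto simp: unitary_mat_def)
  have cU': "mat_adjoint U \<in> carrier_mat n n" and cV': "mat_adjoint V \<in> carrier_mat n n"
    using cU cV mat_adjoint_carrier by blast+
  have cW: "W \<in> carrier_mat n n" using cU cV' by (simp add: W_def)
  have UU: "mat_adjoint U * U = 1\<^sub>m n" "U * mat_adjoint U = 1\<^sub>m n"
    and VV: "mat_adjoint V * V = 1\<^sub>m n" "V * mat_adjoint V = 1\<^sub>m n"
    using U V by (auto simp: unitary_mat_def)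
  have key: "W * D = E * W \<longleftrightarrow> U * D * mat_adjoint U = V * E * mat_adjoint V"
    if D: "D \<in> carrier_mat n n" and E: "E \<in> carrier_mat n n" for D E :: "complex mat"
  proof
    have "V * (W * D) * mat_adjoint U = (V * mat_adjoint V) * (U * D * mat_adjoint U)"
      using D cU cV cU' cV' by (simp add: W_def assoc_mult_mat[of _ n n _ n _ n])
    then have 1: "V * (W * D) * mat_adjoint U = U * D * mat_adjoint U"
      using VV D cU cU' by simp
    have "V * (E * W) * mat_adjoint U = V * E * mat_adjoint V * (U * mat_adjoint U)"
      using E cU cV cU' cV' by (simp add: W_def assoc_mult_mat[of _ n n _ n _ n])
    then have 2: "V * (E * W) * mat_adjoint U = V * E * mat_adjoint V"
      using UU E cV cV' by simp
    show "U * D * mat_adjoint U = V * E * mat_adjoint V" if "W * D = E * W"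
      using 1 2 that by simp
    have "mat_adjoint V * (U * D * mat_adjoint U) * U = W * D * (mat_adjoint U * U)"
      using D cU cV cU' cV' by (simp add: W_def assoc_mult_mat[of _ n n _ n _ n])
    then have 3: "mat_adjoint V * (U * D * mat_adjoint U) * U = W * D"
      using UU D cW by simp
    have "mat_adjoint V * (V * E * mat_adjoint V) * U = (mat_adjoint V * V) * (E * W)"
      using E cU cV cU' cV' by (simp add: W_def assoc_mult_mat[of _ n n _ n _ n])
    then have 4: "mat_adjoint V * (V * E * mat_adjoint V) * U = E * W"
      using VV E cW by simp
    show "W * D = E * W" if "U * D * mat_adjoint U = V * E * mat_adjoint V"
      using 3 4 that by simp
  qed
  have entries: "W * mat_diag n g = mat_diag n h * W \<longleftrightarrow>
      (\<forall>i<n. \<forall>j<n. W $$ (i, j) * g j = h i * W $$ (i, j))" for g h :: "nat \<Rightarrow> complex"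
    using cW by (auto simp: mat_diag_mult_left[OF cW] mat_diag_mult_right[OF cW] mat_eq_iff)
  have "W * mat_diag n (\<lambda>i. complex_of_real (l i)) = mat_diag n (\<lambda>i. complex_of_real (m i)) * W"
    using key eq by simp
  then have "\<forall>i<n. \<forall>j<n. W $$ (i, j) = 0 \<or> l j = m i"
    unfolding entries by (auto simp: mult.commute)
  then have "W * mat_diag n (\<lambda>i. complex_of_real (f (l i))) =
      mat_diag n (\<lambda>i. complex_of_real (f (m i))) * W"
    unfolding entries by fastforce
  then show ?thesis using key by simp
qed

lemma mat_fun_eq:
  assumes U: "unitary_mat n U"
    and A: "A = U * mat_diag n (\<lambda>i. complex_of_real (l i)) * mat_adjoint U"
  shows "mat_fun f A = U * mat_diag n (\<lambda>i. complex_of_real (f (l i))) * mat_adjoint U"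
proof -
  have dim: "dim_row A = n"
    using U A by (auto simp: unitary_mat_def)
  show ?thesis
    unfolding mat_fun_def dim
  proof (rule the_equality)
    show "\<exists>V m. unitary_mat n V \<and>
        A = V * mat_diag n (\<lambda>i. complex_of_real (m i)) * mat_adjoint V \<and>
        U * mat_diag n (\<lambda>i. complex_of_real (f (l i))) * mat_adjoint U =
        V * mat_diag n (\<lambda>i. complex_of_real (f (m i))) * mat_adjoint V"
      using U A by blast
  next
    fix B
    assume "\<exists>V m. unitary_mat n V \<and>
        A = V * mat_diag n (\<lambda>i. complex_of_real (m i)) * mat_adjoint V \<and>
        B = V * mat_diag n (\<lambda>i. complex_of_real (f (m i))) * mat_adjoint V"
    then show "B = U * mat_diag n (\<lambda>i. complex_of_real (f (l i))) * mat_adjoint U"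
      using unitary_diag_fun_unique[OF _ U] A by metis
  qed
qed

(* The convention 0 log 0 = 0 holds automatically, log 2 being a total function. *)
definition vn_entropy :: "complex mat \<Rightarrow> real" where
  "vn_entropy \<rho> = - Re (mat_trace (\<rho> * mat_fun (log 2) \<rho>))"

definition information :: "nat \<Rightarrow> complex mat \<Rightarrow> real" where
  "information d \<rho> = log 2 (real d) - vn_entropy \<rho>"

definition trace_norm :: "complex mat \<Rightarrow> real" where
  "trace_norm A = Re (mat_trace (mat_fun sqrt (mat_adjoint A * A)))"

(* The basis vector e_i \<otimes> e_k of C^a \<otimes> C^b is numbered i * b + k, both in
   kronecker and in partial_trace. *)
definition kronecker :: "complex mat \<Rightarrow> complex mat \<Rightarrow> complex mat" where
  "kronecker A B = mat (dim_row A * dim_row B) (dim_col A * dim_col B)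
     (\<lambda>(i, j). A $$ (i div dim_row B, j div dim_col B) * B $$ (i mod dim_row B, j mod dim_col B))"

primrec tensor_power :: "complex mat \<Rightarrow> nat \<Rightarrow> complex mat" where
  "tensor_power A 0 = 1\<^sub>m 1"
| "tensor_power A (Suc n) = kronecker (tensor_power A n) A"

definition partial_trace :: "nat \<Rightarrow> nat \<Rightarrow> complex mat \<Rightarrow> complex mat" where
  "partial_trace a b A = mat a a (\<lambda>(i, j). \<Sum>k<b. A $$ (i * b + k, j * b + k))"

(* noisy_op m n L: L is a noisy operation from states on C^m to states on C^n; only the
   values of L on such states matter.  In discard the unitary V is the identification of
   the Hilbert space with C^a \<otimes> C^b; as V may include a swap of the factors, tracing out
   the second factor covers the first one too.  The empty composition is unitary with
   U = 1. *)
inductive noisy_op :: "nat \<Rightarrow> nat \<Rightarrow> (complex mat \<Rightarrow> complex mat) \<Rightarrow> bool" where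
  unitary: "unitary_mat n U \<Longrightarrow> noisy_op n n (\<lambda>X. U * X * mat_adjoint U)"
| ancilla: "K > 0 \<Longrightarrow> noisy_op n (n * K) (\<lambda>X. kronecker X (max_mixed K))"
| discard: "a > 0 \<Longrightarrow> b > 0 \<Longrightarrow> unitary_mat (a * b) V \<Longrightarrow>
    noisy_op (a * b) a (\<lambda>X. partial_trace a b (V * X * mat_adjoint V))"
| compose: "noisy_op n m L \<Longrightarrow> noisy_op m k M \<Longrightarrow> noisy_op n k (\<lambda>X. M (L X))"

definition achievable_rate :: "complex mat \<Rightarrow> complex mat \<Rightarrow> real \<Rightarrow> bool" where
  "achievable_rate \<rho> \<sigma> r \<longleftrightarrow> (\<exists>(m :: nat \<Rightarrow> nat) (L :: nat \<Rightarrow> complex mat \<Rightarrow> complex mat).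
     (\<lambda>n. real (m n) / real n) \<longlonglongrightarrow> r \<and>
     (\<forall>n. noisy_op (dim_row \<rho> ^ n) (dim_row \<sigma> ^ m n) (L n)) \<and>
     (\<lambda>n. trace_norm (L n (tensor_power \<rho> n) - tensor_power \<sigma> (m n))) \<longlonglongrightarrow> 0)"

(* Extended reals, since the rate from a pure to a maximally mixed state is infinite. *)
definition optimal_rate :: "complex mat \<Rightarrow> complex mat \<Rightarrow> ereal" where
  "optimal_rate \<rho> \<sigma> = Sup (ereal ` {r. achievable_rate \<rho> \<sigma> r})"

end

(*
Diagonalising the states and absorbing the diagonalising unitaries into the
noisy operations reduces everything to product distributions p^n on d^n points.
Let H be the entropy of p and I = log d - H. By Chebyshev's inequality, p^n is
carried, up to vanishing mass, by points of probability between 2^(-n(H+delta))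
and 2^(-n(H-delta)).

Converse: a noisy operation L from dimension N to dimension M is positive,
trace preserving and maps 1 to (N/M) 1. If a state is below c 1 up to mass
epsilon, then a rank-t projection has probability at most c (N/M) t + epsilon
on its image. For rho -> pi, take c = 2^(-n(H-delta)), N = d^n, M = 2^m, t = 1;
for pi -> rho, take c = 1, N = 2^n, M = d^m, t = 2^(m(H+delta)).

Achievability: adding a K-dimensional ancilla, permuting the basis and discarding
a factor realises any block averaging of the spectrum diluted by K. For
rho -> pi, the diluted typical set fits into one block as soon as
2^(n(H+delta)) 2^m <= d^n. For pi -> rho, the pure state dilutes to a uniform
distribution on K points, of which each block may receive up to its size; this
approximates any distribution on d^m points with values at most 2^n / d^m.
*)
theory Submission
  imports Defs "Jordan_Normal_Form.Spectral_Radius"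
begin

text \<open>The converse looks only at diagonal entries of the output: additivity and positivity
  make them monotone in the input, the image of the identity bounds them, and the trace norm
  dominates every sum of diagonal entries of a Hermitian matrix. A pure target is tested on one
  basis vector; a target rho^m must be tested on about 2^(mH) of them, the size of its typical set.

  Typicality is used from one side at a time. Large probabilities are the danger in the converse for
  rho -> pi and in the achievability of pi -> rho, small ones in the other two bounds.

  Achievability has to cope with integer block sizes. Places of a block that are still free are
  filled arbitrarily, and probabilities are rounded down to multiples of 1/K with K = d^m (n+1), at
  a total cost of 1/(n+1). Lower bounds on the output suffice in both directions, because two
  distributions with equal total mass have equal total excess and deficit.

  Since delta > 0 is a genuine margin, the constructions reach the rates strictly below the optimum
  and the supremum closes the gap. For I = 0 no such nonnegative rate to pi exists, so the trivial
  rate 0 is treated separately.\<close>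

section \<open>The spectral theorem\<close>

lemma index_mat_adjoint [simp]:
  "i < dim_col A \<Longrightarrow> j < dim_row A \<Longrightarrow> mat_adjoint A $$ (i, j) = cnj (A $$ (j, i))"
  for A :: "complex mat"
  unfolding mat_adjoint_def by (simp add: mat_of_rows_index)

lemma dim_mat_adjoint [simp]:
  "dim_row (mat_adjoint A) = dim_col A" "dim_col (mat_adjoint A) = dim_row A"
  for A :: "complex mat"
  unfolding mat_adjoint_def by auto

lemma mat_adjoint_adjoint [simp]: "mat_adjoint (mat_adjoint A) = A" for A :: "complex mat"
  by (rule eq_matI) auto

lemma mat_adjoint_one [simp]: "mat_adjoint (1\<^sub>m n) = (1\<^sub>m n :: complex mat)"
  by (rule eq_matI) auto

lemma index_mult_mat_sum:
  "A \<in> carrier_mat n m \<Longrightarrow> B \<in> carrier_mat m k \<Longrightarrow> i < n \<Longrightarrow> j < k \<Longrightarrow>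
   (A * B) $$ (i, j) = (\<Sum>l<m. A $$ (i, l) * B $$ (l, j))"
  by (auto simp: scalar_prod_def atLeast0LessThan)

lemma mat_adjoint_mult:
  assumes "A \<in> carrier_mat n m" "B \<in> carrier_mat m k"
  shows "mat_adjoint (A * B) = mat_adjoint B * mat_adjoint (A :: complex mat)"
proof (rule eq_matI)
  fix i j assume "i < dim_row (mat_adjoint B * mat_adjoint A)" "j < dim_col (mat_adjoint B * mat_adjoint A)"
  then have ij: "i < k" "j < n" using assms by auto
  show "mat_adjoint (A * B) $$ (i, j) = (mat_adjoint B * mat_adjoint A) $$ (i, j)"
    using assms ij
    by (subst index_mat_adjoint, simp, simp,
        subst index_mult_mat_sum[OF assms], simp, simp,
        subst index_mult_mat_sum[OF mat_adjoint_carrier[OF assms(2)] mat_adjoint_carrier[OF assms(1)]])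
       (auto simp: mult.commute intro!: sum.cong)
qed (use assms in auto)

lemma unitary_carrier: "unitary_mat n U \<Longrightarrow> U \<in> carrier_mat n n"
  by (simp add: unitary_mat_def)

lemma unitary_adjoint_carrier: "unitary_mat n U \<Longrightarrow> mat_adjoint U \<in> carrier_mat n n"
  by (simp add: unitary_mat_def mat_adjoint_carrier)

lemma unitary_one: "unitary_mat n (1\<^sub>m n)"
  by (simp add: unitary_mat_def)

lemma unitary_adjoint: "unitary_mat n U \<Longrightarrow> unitary_mat n (mat_adjoint U)"
  by (simp add: unitary_mat_def mat_adjoint_carrier)

lemma unitary_cancel:
  assumes U: "unitary_mat n U" and A: "A \<in> carrier_mat n m"
  shows "mat_adjoint U * (U * A) = A" "U * (mat_adjoint U * A) = A"
  using assms unitary_adjoint_carrier[OF U]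
  by (auto simp: unitary_mat_def assoc_mult_mat[symmetric, of _ n n _ n _ m])

lemma unitary_cancel_right:
  assumes U: "unitary_mat n U" and A: "A \<in> carrier_mat m n"
  shows "A * mat_adjoint U * U = A" "A * U * mat_adjoint U = A"
  using assms unitary_adjoint_carrier[OF U]
  by (auto simp: unitary_mat_def assoc_mult_mat[of _ m n _ n _ n])

lemma unitary_mult:
  assumes U: "unitary_mat n U" and V: "unitary_mat n V"
  shows "unitary_mat n (U * V)"
proof -
  note c = unitary_carrier[OF U] unitary_carrier[OF V] unitary_adjoint_carrier[OF U] unitary_adjoint_carrier[OF V]
  have 1: "mat_adjoint (U * V) = mat_adjoint V * mat_adjoint U"
    using mat_adjoint_mult c by blast
  have "mat_adjoint V * mat_adjoint U * (U * V) = mat_adjoint V * (mat_adjoint U * (U * V))"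
    using c by (simp add: assoc_mult_mat[of _ n n _ n _ n])
  also have "\<dots> = 1\<^sub>m n" using unitary_cancel(1)[OF U c(2)] V by (simp add: unitary_mat_def)
  finally have 2: "mat_adjoint V * mat_adjoint U * (U * V) = 1\<^sub>m n" .
  have "U * V * (mat_adjoint V * mat_adjoint U) = U * (V * (mat_adjoint V * mat_adjoint U))"
    using c by (simp add: assoc_mult_mat[of _ n n _ n _ n])
  also have "\<dots> = 1\<^sub>m n" using unitary_cancel(2)[OF V c(3)] U by (simp add: unitary_mat_def)
  finally have 3: "U * V * (mat_adjoint V * mat_adjoint U) = 1\<^sub>m n" .
  show ?thesis using c 1 2 3 by (simp add: unitary_mat_def)
qed

text \<open>Orthonormal columns suffice because a left inverse of a square matrix is also a right
  inverse.\<close>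

lemma unitaryI:
  assumes "U \<in> carrier_mat n n"
    and "\<And>i j. i < n \<Longrightarrow> j < n \<Longrightarrow> (\<Sum>k<n. cnj (U $$ (k, i)) * U $$ (k, j)) = (if i = j then 1 else 0)"
  shows "unitary_mat n U"
proof -
  note c = mat_adjoint_carrier[OF assms(1)]
  have "mat_adjoint U * U = 1\<^sub>m n"
  proof (rule eq_matI)
    fix i j assume "i < dim_row (1\<^sub>m n)" "j < dim_col (1\<^sub>m n)"
    then have ij: "i < n" "j < n" by auto
    show "(mat_adjoint U * U) $$ (i, j) = 1\<^sub>m n $$ (i, j)"
      using assms(2)[OF ij] assms(1) ij by (subst index_mult_mat_sum[OF c assms(1) ij]) simp
  qed (use assms(1) in auto)
  then show ?thesis
    using assms(1) c mat_mult_left_right_inverse[OF c assms(1)] by (simp add: unitary_mat_def)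
qed

lemma mat_adjoint_conj:
  assumes "U \<in> carrier_mat n m" "A \<in> carrier_mat m m"
  shows "mat_adjoint (U * A * mat_adjoint U) = U * mat_adjoint A * mat_adjoint (U :: complex mat)"
proof -
  have "mat_adjoint (U * A * mat_adjoint U) = U * mat_adjoint (U * A)"
    by (subst mat_adjoint_mult[of _ n m _ n]) (use assms mat_adjoint_carrier in auto)
  also have "mat_adjoint (U * A) = mat_adjoint A * mat_adjoint U"
    by (rule mat_adjoint_mult[OF assms])
  finally show ?thesis
    using assms by (simp add: assoc_mult_mat[of _ n m _ m _ n] mat_adjoint_carrier)
qed

lemma mat_adjoint_diag_real [simp]:
  "mat_adjoint (mat_diag n (\<lambda>i. complex_of_real (f i))) = mat_diag n (\<lambda>i. complex_of_real (f i))"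
  by (rule eq_matI) (auto simp: mat_diag_def)

lemma conj_conj:
  assumes U: "U \<in> carrier_mat n n" and V: "V \<in> carrier_mat n n" and A: "A \<in> carrier_mat n n"
  shows "U * (V * A * mat_adjoint V) * mat_adjoint U = (U * V) * A * mat_adjoint (U * (V :: complex mat))"
  using assms mat_adjoint_carrier[OF U] mat_adjoint_carrier[OF V]
  by (simp add: mat_adjoint_mult[OF U V] assoc_mult_mat[of _ n n _ n _ n])

lemma conj_cancel:
  assumes U: "unitary_mat n U" and A: "A \<in> carrier_mat n n"
  shows "mat_adjoint U * (U * A * mat_adjoint U) * U = A"
    and "U * (mat_adjoint U * A * U) * mat_adjoint U = A"
proof -
  note c = unitary_carrier[OF U] unitary_adjoint_carrier[OF U]
  have "mat_adjoint U * (U * A * mat_adjoint U) = mat_adjoint U * (U * A) * mat_adjoint U"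
    using c A by (intro assoc_mult_mat[symmetric, of _ n n _ n _ n]) auto
  then show "mat_adjoint U * (U * A * mat_adjoint U) * U = A"
    by (simp only: unitary_cancel[OF U A] unitary_cancel_right[OF U A])
  have "U * (mat_adjoint U * A * U) = U * (mat_adjoint U * A) * U"
    using c A by (intro assoc_mult_mat[symmetric, of _ n n _ n _ n]) auto
  then show "U * (mat_adjoint U * A * U) * mat_adjoint U = A"
    by (simp only: unitary_cancel[OF U A] unitary_cancel_right[OF U A])
qed

text \<open>Extend \<open>v\<close> to a basis and orthogonalise. Gram-Schmidt keeps the first
  vector of the list, so column 0 is \<open>v\<close> up to normalisation.\<close>

lemma unitary_completion:
  assumes v: "v \<in> carrier_vec n" and v0: "v \<noteq> 0\<^sub>v n"
  shows "\<exists>U c. unitary_mat n U \<and> col U 0 = c \<cdot>\<^sub>v (v :: complex vec)"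
proof -
  interpret cof_vec_space n "TYPE(complex)" .
  define b where "b = basis_completion v"
  define ws where "ws = gram_schmidt n b"
  from basis_completion[OF v v0, folded b_def]
  have dist_b: "distinct b" and indep: "\<not> lin_dep (set b)" and b: "set b \<subseteq> carrier_vec n"
    and hdb: "hd b = v" and len_b: "length b = n" by auto
  have n: "n \<noteq> 0" using v v0 by auto
  from hdb len_b n obtain vs where bv: "b = v # vs" by (cases b, auto)
  from gram_schmidt_result[OF b dist_b indep refl, folded ws_def]
  have ws: "set ws \<subseteq> carrier_vec n" "corthogonal ws" "length ws = n"
    by (auto simp: len_b)
  from gram_schmidt_hd[OF v, of vs, folded bv] have hdws: "hd ws = v" unfolding ws_def .
  define s where "s i = (\<Sum>k<n. (cmod (ws ! i $ k))\<^sup>2)" for i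
  have wsc: "ws ! i \<in> carrier_vec n" if "i < n" for i using ws that by auto
  have sp: "ws ! i \<bullet>c ws ! j = (\<Sum>k<n. ws ! i $ k * cnj (ws ! j $ k))" if "i < n" "j < n" for i j
    using wsc[OF that(1)] wsc[OF that(2)] by (auto simp: scalar_prod_def atLeast0LessThan)
  have sii: "ws ! i \<bullet>c ws ! i = complex_of_real (s i)" if "i < n" for i
    unfolding sp[OF that that] s_def of_real_sum
    by (simp add: complex_mult_cnj cmod_power2)
  have orth: "(ws ! i \<bullet>c ws ! j = 0) = (i \<noteq> j)" if "i < n" "j < n" for i j
    using corthogonalD[OF ws(2)] that ws(3) by auto
  have s0: "s i > 0" if "i < n" for i
  proof -
    have "s i \<ge> 0" unfolding s_def by (simp add: sum_nonneg)
    moreover have "s i \<noteq> 0" using orth[OF that that] sii[OF that] by auto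
    ultimately show ?thesis by simp
  qed
  \<comment> \<open>The vectors \<open>ws\<close> are orthogonal and nonzero but not normalised;
    \<open>s i\<close> is the squared length of the i-th one.\<close>
  define U where "U = Matrix.mat n n (\<lambda>(k, i). complex_of_real (1 / sqrt (s i)) * ws ! i $ k)"
  have "unitary_mat n U"
  proof (rule unitaryI)
    show "U \<in> carrier_mat n n" by (simp add: U_def)
    fix i j assume ij: "i < n" "j < n"
    have "(\<Sum>k<n. cnj (U $$ (k, i)) * U $$ (k, j)) =
       complex_of_real (1 / sqrt (s i)) * complex_of_real (1 / sqrt (s j)) * (ws ! j \<bullet>c ws ! i)"
      using ij by (simp add: U_def sp sum_distrib_left mult_ac)
    also have "\<dots> = (if i = j then 1 else 0)"
    proof (cases "i = j")
      case True
      have "complex_of_real (1 / sqrt (s i)) * complex_of_real (1 / sqrt (s i)) * complex_of_real (s i)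
          = complex_of_real (1 / sqrt (s i) * (1 / sqrt (s i)) * s i)" by (simp only: of_real_mult)
      also have "1 / sqrt (s i) * (1 / sqrt (s i)) * s i = 1" using s0[OF ij(1)] by (simp add: field_simps)
      finally show ?thesis using True ij by (simp add: sii)
    next
      case False
      then show ?thesis using orth[of j i] ij by simp
    qed
    finally show "(\<Sum>k<n. cnj (U $$ (k, i)) * U $$ (k, j)) = (if i = j then 1 else 0)" .
  qed
  moreover have "col U 0 = complex_of_real (1 / sqrt (s 0)) \<cdot>\<^sub>v v" if ws0: "ws ! 0 = v"
    using n v ws0 by (intro eq_vecI) (auto simp: U_def)
  moreover have "ws ! 0 = v" using hdws ws(3) n by (cases ws) auto
  ultimately show ?thesis by blast
qed

lemma block_diag_mult:
  assumes "A \<in> carrier_mat m m" "B \<in> carrier_mat m m" "C \<in> carrier_mat n n" "D \<in> carrier_mat n n"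
  shows "four_block_mat A (0\<^sub>m m n) (0\<^sub>m n m) C * four_block_mat B (0\<^sub>m m n) (0\<^sub>m n m) D
    = four_block_mat (A * B) (0\<^sub>m m n) (0\<^sub>m n m) (C * (D :: complex mat))"
  using assms by (subst mult_four_block_mat[of _ m m _ n _ n _ _ m _ n]) auto

lemma unitary_four_block:
  assumes "unitary_mat n U"
  shows "unitary_mat (Suc n) (four_block_mat (1\<^sub>m 1) (0\<^sub>m 1 n) (0\<^sub>m n 1) U)"
    and "mat_adjoint (four_block_mat (1\<^sub>m 1) (0\<^sub>m 1 n) (0\<^sub>m n 1) U) =
      four_block_mat (1\<^sub>m 1) (0\<^sub>m 1 n) (0\<^sub>m n 1) (mat_adjoint U)"
proof -
  note U = unitary_carrier[OF assms] unitary_adjoint_carrier[OF assms]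
  show adj: "mat_adjoint (four_block_mat (1\<^sub>m 1) (0\<^sub>m 1 n) (0\<^sub>m n 1) U) =
      four_block_mat (1\<^sub>m 1) (0\<^sub>m 1 n) (0\<^sub>m n 1) (mat_adjoint U)"
    using U(1) by (intro eq_matI) auto
  have one: "four_block_mat (1\<^sub>m 1) (0\<^sub>m 1 n) (0\<^sub>m n 1) (1\<^sub>m n) = (1\<^sub>m (Suc n) :: complex mat)"
    by (intro eq_matI) auto
  note m = block_diag_mult[OF one_carrier_mat one_carrier_mat, unfolded left_mult_one_mat[OF one_carrier_mat]]
  show "unitary_mat (Suc n) (four_block_mat (1\<^sub>m 1) (0\<^sub>m 1 n) (0\<^sub>m n 1) U)"
    unfolding unitary_mat_def adj m[OF U] m[OF U(2,1)]
    using assms one by (auto simp: unitary_mat_def)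
qed

text \<open>Deflation: in an orthonormal basis starting with an eigenvector the first column is zero
  below its first entry, hermiticity clears the first row as well, and the induction hypothesis
  diagonalises the remaining block.\<close>

theorem hermitian_spectral:
  assumes "A \<in> carrier_mat n n" "mat_adjoint A = A"
  shows "\<exists>U l. unitary_mat n U \<and> A = U * mat_diag n (\<lambda>i. complex_of_real (l i)) * mat_adjoint U"
  using assms
proof (induction n arbitrary: A)
  case 0
  then show ?case
    by (intro exI[of _ "1\<^sub>m 0"]) (auto simp: unitary_one intro!: eq_matI)
next
  case (Suc n A)
  note A = Suc.prems(1)
  from spectrum_non_empty[OF A] obtain e where "eigenvalue A e"
    unfolding spectrum_def by auto
  then obtain v where v: "v \<in> carrier_vec (Suc n)" "v \<noteq> 0\<^sub>v (Suc n)" "A *\<^sub>v v = e \<cdot>\<^sub>v v"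
    using A unfolding eigenvalue_def eigenvector_def by auto
  obtain U c where U: "unitary_mat (Suc n) U" and c: "col U 0 = c \<cdot>\<^sub>v v"
    using unitary_completion[OF v(1,2)] by blast
  note cU = unitary_carrier[OF U] and cU' = unitary_adjoint_carrier[OF U]
  define B where "B = mat_adjoint U * A * U"
  have cB: "B \<in> carrier_mat (Suc n) (Suc n)" using cU cU' A by (simp add: B_def)
  have BA: "U * B * mat_adjoint U = A" unfolding B_def by (rule conj_cancel(2)[OF U A])
  have hB: "mat_adjoint B = B"
    using mat_adjoint_conj[OF cU' A] Suc.prems(2) by (simp add: B_def)
  have col0: "B $$ (i, 0) = (if i = 0 then e else 0)" if i: "i < Suc n" for i
  proof -
    have "col (A * U) 0 = A *\<^sub>v col U 0" using A cU by (auto intro!: eq_vecI)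
    also have "\<dots> = e \<cdot>\<^sub>v col U 0"
      unfolding c using v A by (simp add: mult_mat_vec[of A "Suc n" "Suc n"] smult_smult_assoc mult.commute)
    finally have "col (A * U) 0 = e \<cdot>\<^sub>v col U 0" .
    then have 1: "(A * U) $$ (k, 0) = e * U $$ (k, 0)" if "k < Suc n" for k
      using that A cU by (metis carrier_matD index_col index_mult_mat(2,3) index_smult_vec(1) dim_col zero_less_Suc)
    have "B $$ (i, 0) = (\<Sum>k<Suc n. mat_adjoint U $$ (i, k) * (A * U) $$ (k, 0))"
      unfolding B_def assoc_mult_mat[OF cU' A cU]
      by (rule index_mult_mat_sum[OF cU' mult_carrier_mat[OF A cU] i]) simp
    also have "\<dots> = e * (\<Sum>k<Suc n. mat_adjoint U $$ (i, k) * U $$ (k, 0))"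
      unfolding sum_distrib_left by (rule sum.cong) (auto simp: 1)
    also have "(\<Sum>k<Suc n. mat_adjoint U $$ (i, k) * U $$ (k, 0)) = (mat_adjoint U * U) $$ (i, 0)"
      using cU cU' i by (subst index_mult_mat_sum[of _ "Suc n" "Suc n" _ "Suc n"]) auto
    also have "\<dots> = (if i = 0 then 1 else 0)" using U i by (simp add: unitary_mat_def)
    finally show ?thesis by simp
  qed
  have row0: "B $$ (0, i) = (if i = 0 then cnj e else 0)" if i: "i < Suc n" for i
  proof -
    have "B $$ (0, i) = mat_adjoint B $$ (0, i)" by (simp only: hB)
    also have "\<dots> = cnj (B $$ (i, 0))" using cB i by simp
    finally show ?thesis using col0[OF i] by simp
  qed
  \<comment> \<open>The entry (0, 0) is computed once from the column and once from the row, so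
    \<open>e\<close> equals its conjugate.\<close>
  have e: "e = complex_of_real (Re e)"
    using row0[of 0] col0[of 0] by (simp add: complex_eq_iff)
  define C where "C = Matrix.mat n n (\<lambda>(i, j). B $$ (Suc i, Suc j))"
  have cC: "C \<in> carrier_mat n n" by (simp add: C_def)
  have hC: "mat_adjoint C = C"
  proof (rule eq_matI)
    fix i j assume "i < dim_row C" "j < dim_col C"
    then have ij: "i < n" "j < n" using cC by auto
    have "B $$ (Suc i, Suc j) = mat_adjoint B $$ (Suc i, Suc j)" by (simp only: hB)
    also have "\<dots> = cnj (B $$ (Suc j, Suc i))" using cB ij by simp
    finally show "mat_adjoint C $$ (i, j) = C $$ (i, j)" using ij by (simp add: C_def)
  qed (use cC in auto)
  from Suc.IH[OF cC hC] obtain V l where V: "unitary_mat n V"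
    and CV: "C = V * mat_diag n (\<lambda>i. complex_of_real (l i)) * mat_adjoint V" by blast
  define l' where "l' i = (case i of 0 \<Rightarrow> Re e | Suc i \<Rightarrow> l i)" for i
  define W where "W = four_block_mat (1\<^sub>m 1) (0\<^sub>m 1 n) (0\<^sub>m n 1) V"
  note W = unitary_four_block[OF V, folded W_def]
  note cV = unitary_carrier[OF V] unitary_adjoint_carrier[OF V]
  let ?e = "Matrix.mat 1 1 (\<lambda>_. e)"
  have D: "mat_diag (Suc n) (\<lambda>i. complex_of_real (l' i)) =
      four_block_mat ?e (0\<^sub>m 1 n) (0\<^sub>m n 1) (mat_diag n (\<lambda>i. complex_of_real (l i)))"
    using e by (intro eq_matI) (auto simp: mat_diag_def l'_def split: nat.split)
  have E: "?e \<in> carrier_mat 1 1" by simp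
  note dd = mat_diag_dim[of n "\<lambda>i. complex_of_real (l i)"]
  have W1: "W * mat_diag (Suc n) (\<lambda>i. complex_of_real (l' i)) =
      four_block_mat ?e (0\<^sub>m 1 n) (0\<^sub>m n 1) (V * mat_diag n (\<lambda>i. complex_of_real (l i)))"
    unfolding D W_def block_diag_mult[OF one_carrier_mat E cV(1) dd] left_mult_one_mat[OF E] ..
  have "W * mat_diag (Suc n) (\<lambda>i. complex_of_real (l' i)) * mat_adjoint W =
      four_block_mat ?e (0\<^sub>m 1 n) (0\<^sub>m n 1) C"
    unfolding W1 W(2) block_diag_mult[OF E one_carrier_mat mult_carrier_mat[OF cV(1) dd] cV(2)]
      right_mult_one_mat[OF E] CV[symmetric] ..
  also have "\<dots> = B"
  proof (rule eq_matI)
    fix i j assume "i < dim_row B" "j < dim_col B"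
    then have "i < Suc n" "j < Suc n" using cB by auto
    then show "four_block_mat ?e (0\<^sub>m 1 n) (0\<^sub>m n 1) C $$ (i, j) = B $$ (i, j)"
      using row0[of j] col0[of i] e by (cases i; cases j) (auto simp: C_def)
  qed (use cB cC in auto)
  finally have WB: "W * mat_diag (Suc n) (\<lambda>i. complex_of_real (l' i)) * mat_adjoint W = B" .
  have "A = (U * W) * mat_diag (Suc n) (\<lambda>i. complex_of_real (l' i)) * mat_adjoint (U * W)"
    using conj_conj[OF cU unitary_carrier[OF W(1)] mat_diag_dim, of "\<lambda>i. complex_of_real (l' i)"] BA
    unfolding WB by simp
  then show ?case using unitary_mult[OF U W(1)] by blast
qed

section \<open>Typical sequences\<close>

lemma sum_div_mod:
  "(\<Sum>x<a * b. f x) = (\<Sum>i<a. \<Sum>k<b. f (i * b + k))" for f :: "nat \<Rightarrow> 'a :: comm_monoid_add"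
proof -
  have "(\<Sum>x<a * b. f x) = (\<Sum>i<a. sum f {i * b..<i * b + b})"
    by (rule sum.nat_group[symmetric])
  also have "\<dots> = (\<Sum>i<a. \<Sum>k<b. f (i * b + k))"
    using sum.atLeastLessThan_shift_0[of f] by (simp add: atLeast0LessThan add.commute)
  finally show ?thesis .
qed

lemma div_mod_less:
  assumes "x < a * b"
  shows "x div b < a" "x mod b < (b :: nat)"
proof -
  have "0 < b" using assms by (cases b) auto
  then show "x div b < a" "x mod b < b" using assms by (simp_all add: less_mult_imp_div_less)
qed

lemma block_index_less:
  assumes "i < a" "k < b" shows "i * b + k < a * (b :: nat)"
proof -
  have "i * b + k < Suc i * b" using assms by simp
  also have "\<dots> \<le> a * b" using assms(1) by (intro mult_right_mono) auto
  finally show ?thesis .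
qed

text \<open>A sequence of \<open>n\<close> letters is coded by the base-\<open>d\<close> digits of
  \<open>x\<close>, the last letter being the lowest digit. This matches the numbering in
  \<open>kronecker\<close>, so it is the spectrum of the \<open>n\<close>-th tensor power of a
  diagonal state.\<close>

primrec prod_dist :: "nat \<Rightarrow> (nat \<Rightarrow> real) \<Rightarrow> nat \<Rightarrow> nat \<Rightarrow> real" where
  "prod_dist d p 0 x = 1"
| "prod_dist d p (Suc n) x = prod_dist d p n (x div d) * p (x mod d)"

section \<open>Entropy and typicality of a finite distribution\<close>

locale finite_dist =
  fixes d :: nat and p :: "nat \<Rightarrow> real"
  assumes nonneg: "\<And>i. i < d \<Longrightarrow> 0 \<le> p i" and sum_one: "(\<Sum>i<d. p i) = 1"
begin

definition entropy :: real where
  "entropy = - (\<Sum>i<d. p i * log 2 (p i))"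

text \<open>A sum of independent centred variables, one per letter. Defining it letter by letter,
  rather than through the logarithm of the product, lets the second moment be computed without a
  case distinction for vanishing probabilities.\<close>

primrec deviation :: "nat \<Rightarrow> nat \<Rightarrow> real" where
  "deviation 0 x = 0"
| "deviation (Suc n) x = deviation n (x div d) + (log 2 (p (x mod d)) + entropy)"

definition variance :: real where
  "variance = (\<Sum>i<d. p i * (log 2 (p i) + entropy)\<^sup>2)"

lemma d_pos: "d > 0"
  using sum_one by (cases d) auto

lemma sum_power_Suc:
  "(\<Sum>x<d ^ Suc n. f (x div d) (x mod d)) = (\<Sum>x<d ^ n. \<Sum>i<d. f x i)" for f :: "nat \<Rightarrow> nat \<Rightarrow> real"
proof -
  have "d ^ Suc n = d ^ n * d" by simp
  then have "(\<Sum>x<d ^ Suc n. f (x div d) (x mod d)) =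
      (\<Sum>x<d ^ n. \<Sum>i<d. f ((x * d + i) div d) ((x * d + i) mod d))"
    by (simp only: sum_div_mod)
  then show ?thesis by simp
qed

lemma power_Suc_div_mod_less:
  assumes "x < d ^ Suc n" shows "x div d < d ^ n" "x mod d < d"
  using div_mod_less[of x "d ^ n" d] assms by (simp_all add: mult.commute)

lemma prod_dist_nonneg: "x < d ^ n \<Longrightarrow> 0 \<le> prod_dist d p n x"
  by (induction n arbitrary: x)
     (simp_all add: power_Suc_div_mod_less nonneg mult_nonneg_nonneg del: power_Suc)

lemma prod_dist_sum: "(\<Sum>x<d ^ n. prod_dist d p n x) = 1"
proof (induction n)
  case (Suc n)
  show ?case
    by (simp only: prod_dist.simps sum_power_Suc[of "\<lambda>x i. prod_dist d p n x * p i"]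
        sum_distrib_left[symmetric] sum_one Suc mult_1_right)
qed simp

lemma finite_dist_prod_dist: "finite_dist (d ^ n) (prod_dist d p n)"
  by unfold_locales (auto simp: prod_dist_nonneg prod_dist_sum)

text \<open>On points of probability 0 the two sides differ, as \<open>log 2 0 = 0\<close>.\<close>

lemma deviation_eq:
  "x < d ^ n \<Longrightarrow> 0 < prod_dist d p n x \<Longrightarrow> deviation n x = log 2 (prod_dist d p n x) + n * entropy"
proof (induction n arbitrary: x)
  case (Suc n)
  note b = power_Suc_div_mod_less[OF Suc.prems(1)]
  have "0 < prod_dist d p n (x div d)" "0 < p (x mod d)"
    using Suc.prems(2) prod_dist_nonneg[OF b(1)] nonneg[OF b(2)] by (auto simp: zero_less_mult_iff)
  then show ?case using Suc.IH[OF b(1)] by (simp add: log_mult algebra_simps)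
qed simp

lemma step_mean: "(\<Sum>i<d. p i * (log 2 (p i) + entropy)) = 0"
  unfolding distrib_left sum.distrib sum_distrib_right[symmetric] sum_one by (simp add: entropy_def)

text \<open>Variances of independent summands add: when the square is expanded over the last letter,
  the cross term carries the factor \<open>step_mean\<close>, which is 0.\<close>

lemma deviation_variance: "(\<Sum>x<d ^ n. prod_dist d p n x * (deviation n x)\<^sup>2) = n * variance"
proof (induction n)
  case (Suc n)
  let ?y = "\<lambda>i. log 2 (p i) + entropy"
  have "(\<Sum>x<d ^ Suc n. prod_dist d p (Suc n) x * (deviation (Suc n) x)\<^sup>2)
    = (\<Sum>x<d ^ n. \<Sum>i<d. prod_dist d p n x * p i * (deviation n x + ?y i)\<^sup>2)"
    unfolding prod_dist.simps deviation.simps by (rule sum_power_Suc)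
  also have "\<dots> = (\<Sum>x<d ^ n. prod_dist d p n x * (deviation n x)\<^sup>2 * (\<Sum>i<d. p i) +
      2 * (prod_dist d p n x * deviation n x) * (\<Sum>i<d. p i * ?y i) +
      prod_dist d p n x * (\<Sum>i<d. p i * (?y i)\<^sup>2))"
    unfolding sum_distrib_left sum.distrib[symmetric]
    by (intro sum.cong refl) (simp add: algebra_simps power2_eq_square)
  also have "\<dots> = real (Suc n) * variance"
    unfolding step_mean sum_one variance_def[symmetric] sum.distrib
    unfolding sum_distrib_right[symmetric] prod_dist_sum by (simp add: Suc algebra_simps)
  finally show ?case .
qed simp

text \<open>Chebyshev's inequality: on \<open>B\<close> the deviation is at least
  \<open>n * \<delta>\<close> in absolute value wherever there is mass, while its second moment
  grows only linearly in \<open>n\<close>. Points of probability 0 may belong to \<open>B\<close>,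
  as they contribute nothing to the sum.\<close>

lemma atypical_mass:
  assumes "\<delta> > 0" and "n > 0"
    and B: "\<And>x. x \<in> B \<Longrightarrow> x < d ^ n \<and> (prod_dist d p n x > 0 \<longrightarrow>
      n * \<delta> \<le> \<bar>log 2 (prod_dist d p n x) + n * entropy\<bar>)"
  shows "(\<Sum>x\<in>B. prod_dist d p n x) \<le> variance / \<delta>\<^sup>2 * (1 / real n)"
proof -
  have sub: "B \<subseteq> {..<d ^ n}" using B by auto
  then have fin: "finite B" by (rule finite_subset) simp
  have "(n * \<delta>)\<^sup>2 * (\<Sum>x\<in>B. prod_dist d p n x) \<le> (\<Sum>x\<in>B. prod_dist d p n x * (deviation n x)\<^sup>2)"
    unfolding sum_distrib_left
  proof (rule sum_mono)
    fix x assume x: "x \<in> B"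
    show "(n * \<delta>)\<^sup>2 * prod_dist d p n x \<le> prod_dist d p n x * (deviation n x)\<^sup>2"
    proof (cases "prod_dist d p n x > 0")
      case True
      then have "n * \<delta> \<le> \<bar>deviation n x\<bar>" using B[OF x] deviation_eq[of x n] by simp
      then have "(n * \<delta>)\<^sup>2 \<le> \<bar>deviation n x\<bar>\<^sup>2" using assms(1) by (intro power_mono) auto
      then show ?thesis using True by (simp add: mult.commute)
    next
      case False
      then have "prod_dist d p n x = 0" using prod_dist_nonneg[of x n] B[OF x] by auto
      then show ?thesis by simp
    qed
  qed
  also have "\<dots> \<le> (\<Sum>x<d ^ n. prod_dist d p n x * (deviation n x)\<^sup>2)"
    using sub by (intro sum_mono2) (auto simp: prod_dist_nonneg)
  also have "\<dots> = n * variance" by (rule deviation_variance)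
  finally show ?thesis using assms(1,2) by (simp add: field_simps power2_eq_square)
qed

text \<open>The two sides of atypicality are kept apart because each rate bound discards only one of
  them.\<close>

definition low_tail :: "real \<Rightarrow> nat \<Rightarrow> real" where
  "low_tail \<delta> n = (\<Sum>x | x < d ^ n \<and> prod_dist d p n x < 2 powr (- (real n * (entropy + \<delta>))). prod_dist d p n x)"

definition high_tail :: "real \<Rightarrow> nat \<Rightarrow> real" where
  "high_tail \<delta> n = (\<Sum>x | x < d ^ n \<and> 2 powr (- (real n * (entropy - \<delta>))) < prod_dist d p n x. prod_dist d p n x)"

lemma tail_tendsto_0:
  assumes "\<And>n. n > 0 \<Longrightarrow> 0 \<le> f n \<and> f n \<le> c * (1 / real n)"
  shows "f \<longlonglongrightarrow> 0"
proof (rule tendsto_sandwich)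
  show "\<forall>\<^sub>F n in sequentially. 0 \<le> f n" "\<forall>\<^sub>F n in sequentially. f n \<le> c * (1 / real n)"
    using assms by (auto intro!: eventually_sequentiallyI[of 1])
  show "(\<lambda>n. c * (1 / real n)) \<longlonglongrightarrow> 0" using tendsto_mult_right_zero[OF lim_1_over_n] by simp
qed simp

lemma low_tail_tendsto: "\<delta> > 0 \<Longrightarrow> low_tail \<delta> \<longlonglongrightarrow> 0"
proof (rule tail_tendsto_0[of _ "variance / \<delta>\<^sup>2"], rule conjI)
  fix n :: nat assume \<delta>: "\<delta> > 0" and n: "n > 0"
  show "0 \<le> low_tail \<delta> n" unfolding low_tail_def by (intro sum_nonneg) (auto simp: prod_dist_nonneg)
  show "low_tail \<delta> n \<le> variance / \<delta>\<^sup>2 * (1 / real n)"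
    unfolding low_tail_def
  proof (rule atypical_mass[OF \<delta> n])
    fix x assume x: "x \<in> {x. x < d ^ n \<and> prod_dist d p n x < 2 powr (- (real n * (entropy + \<delta>)))}"
    have "n * \<delta> \<le> \<bar>log 2 (prod_dist d p n x) + n * entropy\<bar>" if "prod_dist d p n x > 0"
    proof -
      have "log 2 (prod_dist d p n x) < - (real n * (entropy + \<delta>))"
        using x that by (subst log_less_iff) auto
      then show ?thesis by (simp add: algebra_simps)
    qed
    then show "x < d ^ n \<and> (prod_dist d p n x > 0 \<longrightarrow> n * \<delta> \<le> \<bar>log 2 (prod_dist d p n x) + n * entropy\<bar>)"
      using x by simp
  qed
qed

lemma high_tail_tendsto: "\<delta> > 0 \<Longrightarrow> high_tail \<delta> \<longlonglongrightarrow> 0"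
proof (rule tail_tendsto_0[of _ "variance / \<delta>\<^sup>2"], rule conjI)
  fix n :: nat assume \<delta>: "\<delta> > 0" and n: "n > 0"
  show "0 \<le> high_tail \<delta> n" unfolding high_tail_def by (intro sum_nonneg) (auto simp: prod_dist_nonneg)
  show "high_tail \<delta> n \<le> variance / \<delta>\<^sup>2 * (1 / real n)"
    unfolding high_tail_def
  proof (rule atypical_mass[OF \<delta> n])
    fix x assume x: "x \<in> {x. x < d ^ n \<and> 2 powr (- (real n * (entropy - \<delta>))) < prod_dist d p n x}"
    have "n * \<delta> \<le> \<bar>log 2 (prod_dist d p n x) + n * entropy\<bar>" if "prod_dist d p n x > 0"
    proof -
      have "- (real n * (entropy - \<delta>)) < log 2 (prod_dist d p n x)"
        using x that by (subst less_log_iff) auto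
      then show ?thesis by (simp add: algebra_simps)
    qed
    then show "x < d ^ n \<and> (prod_dist d p n x > 0 \<longrightarrow> n * \<delta> \<le> \<bar>log 2 (prod_dist d p n x) + n * entropy\<bar>)"
      using x by simp
  qed
qed

lemma card_ge_le:
  assumes "c > 0" shows "real (card {x. x < d \<and> c \<le> p x}) \<le> 1 / c"
proof -
  have "c * real (card {x. x < d \<and> c \<le> p x}) = (\<Sum>x | x < d \<and> c \<le> p x. c)" by simp
  also have "\<dots> \<le> (\<Sum>x | x < d \<and> c \<le> p x. p x)" by (intro sum_mono) auto
  also have "\<dots> \<le> (\<Sum>x<d. p x)" by (intro sum_mono2) (auto simp: nonneg)
  finally show ?thesis using assms sum_one by (simp add: field_simps)
qed

text \<open>The equality case of Gibbs' inequality relative to the uniform distribution. It turns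
  "not maximally mixed" into positivity of I.\<close>

lemma uniform_if_entropy_maximal:
  assumes "log 2 d \<le> entropy" and i: "i < d"
  shows "p i = 1 / d"
proof -
  \<comment> \<open>A summand of the relative entropy in nats, minus a correction whose total is 0.
    The correction makes every single summand nonnegative: for \<open>p i > 0\<close> it equals
    \<open>p i * (y - 1 - ln y)\<close> with \<open>y = 1 / (d * p i)\<close>, and for
    \<open>p i = 0\<close> it is \<open>1 / d\<close>.\<close>
  define f where "f i = p i * ln (d * p i) - (p i - 1 / d)" for i
  have key: "f i \<ge> 0" "f i = 0 \<Longrightarrow> p i = 1 / d" if "i < d" for i
  proof -
    have "f i \<ge> 0 \<and> (f i = 0 \<longrightarrow> p i = 1 / d)"
    proof (cases "p i = 0")
      case True then show ?thesis using d_pos by (simp add: f_def)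
    next
      case False
      then have pos: "p i > 0" using nonneg[OF that] by simp
      define y where "y = 1 / (d * p i)"
      have y: "y > 0" using pos d_pos by (simp add: y_def)
      have "ln (d * p i) = - ln y" using pos d_pos by (simp add: y_def ln_div)
      moreover have "p i - 1 / d = p i * (1 - y)" using pos d_pos by (simp add: y_def field_simps)
      ultimately have f: "f i = p i * (y - 1 - ln y)" unfolding f_def by (simp add: algebra_simps)
      have "p i = 1 / d" if "f i = 0"
      proof -
        have "ln y = y - 1" using that f pos by simp
        then have "y = 1" using ln_eq_minus_one[OF y] by simp
        then show ?thesis using pos d_pos by (simp add: y_def field_simps)
      qed
      then show ?thesis using f pos ln_le_minus_one[OF y] by simp
    qed
    then show "f i \<ge> 0" "f i = 0 \<Longrightarrow> p i = 1 / d" by auto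
  qed
  have "p i * ln (d * p i) = p i * (ln 2 * log 2 d) + ln 2 * (p i * log 2 (p i))" if "i < d" for i
    using nonneg[OF that] d_pos by (cases "p i = 0") (auto simp: ln_mult log_def field_simps)
  then have "(\<Sum>i<d. p i * ln (d * p i)) = (\<Sum>i<d. p i) * (ln 2 * log 2 d) + ln 2 * (\<Sum>i<d. p i * log 2 (p i))"
    by (simp add: sum.distrib sum_distrib_left sum_distrib_right)
  then have "(\<Sum>i<d. f i) = ln 2 * (log 2 d - entropy)"
    unfolding f_def sum_subtractf using d_pos by (simp add: sum_one entropy_def algebra_simps)
  also have "\<dots> \<le> 0" using assms(1) by (simp add: mult_nonneg_nonpos)
  finally have "(\<Sum>i<d. f i) = 0" using sum_nonneg[of "{..<d}" f] key(1) by force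
  then have "f i = 0" using sum_nonneg_eq_0_iff[of "{..<d}" f] key(1) i by auto
  then show ?thesis using key(2)[OF i] by simp
qed

end

section \<open>Reduction to diagonal states\<close>

abbreviation real_diag :: "nat \<Rightarrow> (nat \<Rightarrow> real) \<Rightarrow> complex mat" where
  "real_diag n p \<equiv> mat_diag n (\<lambda>i. complex_of_real (p i))"

section \<open>Trace norm, entropy and positivity in terms of eigenvalues\<close>

lemma mat_trace_mult_commute:
  assumes "A \<in> carrier_mat n m" "B \<in> carrier_mat m n"
  shows "mat_trace (A * B) = mat_trace (B * A)"
proof -
  have "mat_trace (A * B) = (\<Sum>i<n. \<Sum>k<m. A $$ (i, k) * B $$ (k, i))"
    using assms unfolding mat_trace_def by (simp add: index_mult_mat_sum[OF assms] del: index_mult_mat(1))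
  also have "\<dots> = (\<Sum>k<m. \<Sum>i<n. B $$ (k, i) * A $$ (i, k))"
    by (subst sum.swap) (simp add: mult.commute)
  also have "\<dots> = mat_trace (B * A)"
    using assms unfolding mat_trace_def by (simp add: index_mult_mat_sum[OF assms(2,1)] del: index_mult_mat(1))
  finally show ?thesis .
qed

lemma mat_trace_conj:
  assumes U: "unitary_mat n U" and A: "A \<in> carrier_mat n n"
  shows "mat_trace (U * A * mat_adjoint U) = mat_trace A"
proof -
  note c = unitary_carrier[OF U] unitary_adjoint_carrier[OF U]
  show ?thesis
    using mat_trace_mult_commute[OF mult_carrier_mat[OF c(1) A] c(2)]
    by (simp only: unitary_cancel[OF U A])
qed

lemma mat_trace_diag [simp]: "mat_trace (mat_diag n f) = (\<Sum>i<n. f i)"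
  unfolding mat_trace_def by (simp add: mat_diag_def)

lemma conj_mult:
  assumes U: "unitary_mat n U" and A: "A \<in> carrier_mat n n" and B: "B \<in> carrier_mat n n"
  shows "(U * A * mat_adjoint U) * (U * B * mat_adjoint U) = U * (A * B) * mat_adjoint U"
proof -
  note c = unitary_carrier[OF U] unitary_adjoint_carrier[OF U]
  have "(U * A * mat_adjoint U) * (U * B * mat_adjoint U) = (U * A * mat_adjoint U * (U * B)) * mat_adjoint U"
    using c A B by (intro assoc_mult_mat[symmetric, of _ n n _ n _ n]) auto
  also have "U * A * mat_adjoint U * (U * B) = U * A * (mat_adjoint U * (U * B))"
    using c A B by (intro assoc_mult_mat[of _ n n _ n _ n]) auto
  also have "mat_adjoint U * (U * B) = B" by (rule unitary_cancel[OF U B])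
  also have "U * A * B = U * (A * B)" using c A B by (intro assoc_mult_mat[of _ n n _ n _ n]) auto
  finally show ?thesis .
qed

lemma trace_norm_spectral:
  assumes U: "unitary_mat n U"
  shows "trace_norm (U * real_diag n l * mat_adjoint U) = (\<Sum>i<n. \<bar>l i\<bar>)"
proof -
  let ?A = "U * real_diag n l * mat_adjoint U"
  have "mat_adjoint ?A * ?A = ?A * ?A"
    by (subst mat_adjoint_conj[OF unitary_carrier[OF U] mat_diag_dim]) simp
  also have "\<dots> = U * real_diag n (\<lambda>i. (l i)\<^sup>2) * mat_adjoint U"
    by (subst conj_mult[OF U mat_diag_dim mat_diag_dim]) (simp add: power2_eq_square)
  finally have "mat_fun sqrt (mat_adjoint ?A * ?A) = U * real_diag n (\<lambda>i. sqrt ((l i)\<^sup>2)) * mat_adjoint U"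
    by (rule mat_fun_eq[OF U])
  then have "trace_norm ?A = Re (mat_trace (real_diag n (\<lambda>i. sqrt ((l i)\<^sup>2))))"
    unfolding trace_norm_def by (simp only: mat_trace_conj[OF U mat_diag_dim])
  then show ?thesis by simp
qed

lemma trace_norm_diag: "trace_norm (real_diag n l) = (\<Sum>i<n. \<bar>l i\<bar>)"
  using trace_norm_spectral[OF unitary_one, of n l] 
  by (simp add: right_mult_one_mat[OF mat_diag_dim] left_mult_one_mat[OF mat_diag_dim])

text \<open>Here \<open>A\<close> need not be Hermitian, so the diagonalisation is that of
  \<open>mat_adjoint A * A\<close>, which conjugation by \<open>U\<close> carries along with
  unchanged eigenvalues.\<close>

lemma trace_norm_conj:
  assumes U: "unitary_mat n U" and A: "A \<in> carrier_mat n n"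
  shows "trace_norm (U * A * mat_adjoint U) = trace_norm A"
proof -
  note cU = unitary_carrier[OF U] and cA = mat_adjoint_carrier[OF A]
  have AA: "mat_adjoint A * A \<in> carrier_mat n n" using A cA by simp
  have "mat_adjoint (mat_adjoint A * A) = mat_adjoint A * A"
    by (subst mat_adjoint_mult[OF cA A]) simp
  then obtain V l where V: "unitary_mat n V" and AAV: "mat_adjoint A * A = V * real_diag n l * mat_adjoint V"
    using hermitian_spectral[OF AA] by blast
  have "mat_adjoint (U * A * mat_adjoint U) * (U * A * mat_adjoint U) = U * (mat_adjoint A * A) * mat_adjoint U"
    unfolding mat_adjoint_conj[OF cU A] by (rule conj_mult[OF U cA A])
  also have "\<dots> = (U * V) * real_diag n l * mat_adjoint (U * V)"
    unfolding AAV by (rule conj_conj[OF cU unitary_carrier[OF V] mat_diag_dim])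
  finally have 1: "mat_fun sqrt (mat_adjoint (U * A * mat_adjoint U) * (U * A * mat_adjoint U))
      = (U * V) * real_diag n (\<lambda>i. sqrt (l i)) * mat_adjoint (U * V)"
    by (rule mat_fun_eq[OF unitary_mult[OF U V]])
  have 2: "mat_fun sqrt (mat_adjoint A * A) = V * real_diag n (\<lambda>i. sqrt (l i)) * mat_adjoint V"
    by (rule mat_fun_eq[OF V AAV])
  show ?thesis
    unfolding trace_norm_def 1 2
    by (simp only: mat_trace_conj[OF unitary_mult[OF U V] mat_diag_dim] mat_trace_conj[OF V mat_diag_dim])
qed

lemma vn_entropy_spectral:
  assumes U: "unitary_mat n U"
  shows "vn_entropy (U * real_diag n l * mat_adjoint U) = - (\<Sum>i<n. l i * log 2 (l i))"
  unfolding vn_entropy_def mat_fun_eq[OF U refl] conj_mult[OF U mat_diag_dim mat_diag_dim]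
    mat_diag_diag of_real_mult[symmetric] mat_trace_conj[OF U mat_diag_dim] mat_trace_diag
  by simp

text \<open>The eigenvalue \<open>l i\<close> is the value of the quadratic form at the i-th column
  of \<open>U\<close>.\<close>

lemma psd_eigenvalue_nonneg:
  assumes U: "unitary_mat n U" and psd: "psd_mat n (U * real_diag n l * mat_adjoint U)" and i: "i < n"
  shows "l i \<ge> 0"
proof -
  note c = unitary_carrier[OF U] unitary_adjoint_carrier[OF U]
  define A where "A = U * real_diag n l * mat_adjoint U"
  have A: "A \<in> carrier_mat n n" unfolding A_def by (intro mult_carrier_mat[OF mult_carrier_mat[OF c(1) mat_diag_dim] c(2)])
  have col: "col U i \<in> carrier_vec n" using i by (rule col_carrier_vec[OF _ c(1)])
  have "(A *\<^sub>v col U i) \<bullet>c col U i = (\<Sum>k<n. (A * U) $$ (k, i) * cnj (U $$ (k, i)))"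
    unfolding scalar_prod_def using carrier_matD[OF unitary_carrier[OF U]] carrier_matD[OF A] i
    by (simp add: atLeast0LessThan)
  also have "\<dots> = (\<Sum>k<n. mat_adjoint U $$ (i, k) * (A * U) $$ (k, i))"
    using carrier_matD[OF unitary_carrier[OF U]] i
    by (intro sum.cong refl) (simp add: mult.commute del: index_mult_mat(1))
  also have "\<dots> = (mat_adjoint U * (A * U)) $$ (i, i)"
    by (rule index_mult_mat_sum[symmetric, OF c(2) mult_carrier_mat[OF A c(1)] i i])
  also have "mat_adjoint U * (A * U) = mat_adjoint U * A * U"
    using c A by (intro assoc_mult_mat[symmetric, of _ n n _ n _ n]) auto
  also have "\<dots> = real_diag n l" unfolding A_def by (rule conj_cancel[OF U mat_diag_dim])
  finally have "(A *\<^sub>v col U i) \<bullet>c col U i = complex_of_real (l i)" using i by (simp add: mat_diag_def)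
  moreover have "0 \<le> (A *\<^sub>v col U i) \<bullet>c col U i"
    using psd col unfolding A_def[symmetric] psd_mat_def by blast
  ultimately show ?thesis by (simp add: less_eq_complex_def)
qed

section \<open>Kronecker products and tensor powers\<close>

lemma kronecker_carrier [simp]:
  "A \<in> carrier_mat n m \<Longrightarrow> B \<in> carrier_mat k l \<Longrightarrow> kronecker A B \<in> carrier_mat (n * k) (m * l)"
  unfolding kronecker_def by auto

lemma kronecker_index:
  "A \<in> carrier_mat n m \<Longrightarrow> B \<in> carrier_mat k l \<Longrightarrow> i < n * k \<Longrightarrow> j < m * l \<Longrightarrow>
   kronecker A B $$ (i, j) = A $$ (i div k, j div l) * B $$ (i mod k, j mod l)"
  unfolding kronecker_def by auto

lemma kronecker_mult:
  assumes "A \<in> carrier_mat n n" "B \<in> carrier_mat m m" "C \<in> carrier_mat n n" "D \<in> carrier_mat m m"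
  shows "kronecker A B * kronecker C D = kronecker (A * C) (B * D)"
proof (rule eq_matI)
  fix i j assume "i < dim_row (kronecker (A * C) (B * D))" "j < dim_col (kronecker (A * C) (B * D))"
  then have ij: "i < n * m" "j < n * m" using assms by (auto simp: kronecker_def)
  note cr = kronecker_carrier[OF assms(1,2)] kronecker_carrier[OF assms(3,4)]
  have "(kronecker A B * kronecker C D) $$ (i, j) =
      (\<Sum>x<n * m. kronecker A B $$ (i, x) * kronecker C D $$ (x, j))"
    by (rule index_mult_mat_sum[OF cr ij])
  also have "\<dots> = (\<Sum>x<n * m. A $$ (i div m, x div m) * C $$ (x div m, j div m) *
      (B $$ (i mod m, x mod m) * D $$ (x mod m, j mod m)))"
    by (rule sum.cong) (simp_all add: kronecker_index[OF assms(1,2) ij(1)] kronecker_index[OF assms(3,4) _ ij(2)])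
  also have "\<dots> = (\<Sum>k<n. A $$ (i div m, k) * C $$ (k, j div m)) * (\<Sum>l<m. B $$ (i mod m, l) * D $$ (l, j mod m))"
    unfolding sum_div_mod sum_product by (intro sum.cong refl) simp
  also have "\<dots> = (A * C) $$ (i div m, j div m) * (B * D) $$ (i mod m, j mod m)"
    using div_mod_less[OF ij(1)] div_mod_less[OF ij(2)]
    by (simp only: index_mult_mat_sum[OF assms(1,3)] index_mult_mat_sum[OF assms(2,4)])
  also have "\<dots> = kronecker (A * C) (B * D) $$ (i, j)"
    using kronecker_index[OF mult_carrier_mat[OF assms(1,3)] mult_carrier_mat[OF assms(2,4)] ij] by simp
  finally show "(kronecker A B * kronecker C D) $$ (i, j) = kronecker (A * C) (B * D) $$ (i, j)" .
qed (use assms in \<open>auto simp: kronecker_def\<close>)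

lemma kronecker_adjoint:
  assumes "A \<in> carrier_mat n n" "B \<in> carrier_mat m m"
  shows "mat_adjoint (kronecker A B) = kronecker (mat_adjoint A) (mat_adjoint B)"
proof (rule eq_matI)
  fix i j assume "i < dim_row (kronecker (mat_adjoint A) (mat_adjoint B))" "j < dim_col (kronecker (mat_adjoint A) (mat_adjoint B))"
  then have ij: "i < n * m" "j < n * m" using assms by (auto simp: kronecker_def)
  have "mat_adjoint (kronecker A B) $$ (i, j) = cnj (kronecker A B $$ (j, i))"
    using ij kronecker_carrier[OF assms] by (intro index_mat_adjoint) auto
  also have "\<dots> = kronecker (mat_adjoint A) (mat_adjoint B) $$ (i, j)"
    using div_mod_less[OF ij(1)] div_mod_less[OF ij(2)] ij assms
    by (simp add: kronecker_index[OF assms ij(2,1)]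
        kronecker_index[OF mat_adjoint_carrier[OF assms(1)] mat_adjoint_carrier[OF assms(2)] ij])
  finally show "mat_adjoint (kronecker A B) $$ (i, j) = kronecker (mat_adjoint A) (mat_adjoint B) $$ (i, j)" .
qed (use assms in \<open>auto simp: kronecker_def\<close>)

lemma kronecker_diag: "kronecker (mat_diag n f) (mat_diag m g) = mat_diag (n * m) (\<lambda>x. f (x div m) * g (x mod m))"
proof (rule eq_matI)
  fix i j assume "i < dim_row (mat_diag (n * m) (\<lambda>x. f (x div m) * g (x mod m)))"
    "j < dim_col (mat_diag (n * m) (\<lambda>x. f (x div m) * g (x mod m)))"
  then have ij: "i < n * m" "j < n * m" by (auto simp: mat_diag_def)
  have "i = j" if "i div m = j div m" "i mod m = j mod m"
    using that by (metis div_mult_mod_eq)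
  then show "kronecker (mat_diag n f) (mat_diag m g) $$ (i, j) = mat_diag (n * m) (\<lambda>x. f (x div m) * g (x mod m)) $$ (i, j)"
    using div_mod_less[OF ij(1)] div_mod_less[OF ij(2)] ij
    by (auto simp: kronecker_index[OF mat_diag_dim mat_diag_dim ij]) (auto simp: mat_diag_def)
qed (auto simp: kronecker_def mat_diag_def)

lemma kronecker_one: "kronecker (1\<^sub>m n) (1\<^sub>m m) = 1\<^sub>m (n * m)"
  using kronecker_diag[of n "\<lambda>_. 1" m "\<lambda>_. 1"] by simp

lemma unitary_kronecker:
  assumes "unitary_mat n U" "unitary_mat m V"
  shows "unitary_mat (n * m) (kronecker U V)"
proof -
  note c = unitary_carrier[OF assms(1)] unitary_carrier[OF assms(2)]
  note c' = unitary_adjoint_carrier[OF assms(1)] unitary_adjoint_carrier[OF assms(2)]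
  show ?thesis
    unfolding unitary_mat_def kronecker_adjoint[OF c] kronecker_mult[OF c c'] kronecker_mult[OF c' c]
    using assms c by (simp add: unitary_mat_def kronecker_one)
qed

lemma tensor_power_carrier [simp]: "A \<in> carrier_mat d d \<Longrightarrow> tensor_power A n \<in> carrier_mat (d ^ n) (d ^ n)"
  by (induction n) (auto simp: mult.commute[of d] simp del: kronecker_carrier intro!: kronecker_carrier)

lemma unitary_tensor_power: "unitary_mat d U \<Longrightarrow> unitary_mat (d ^ n) (tensor_power U n)"
  by (induction n) (auto simp: unitary_one mult.commute[of d] intro!: unitary_kronecker)

lemma tensor_power_conj:
  assumes U: "unitary_mat d U" and A: "A \<in> carrier_mat d d"
  shows "tensor_power (U * A * mat_adjoint U) n =
    tensor_power U n * tensor_power A n * mat_adjoint (tensor_power U n)"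
proof (induction n)
  case (Suc n)
  note cU = unitary_carrier[OF U] and cU' = unitary_adjoint_carrier[OF U]
  note cT = tensor_power_carrier[OF cU, of n] and cA = tensor_power_carrier[OF A, of n]
  show ?case
    unfolding tensor_power.simps Suc kronecker_adjoint[OF cT cU]
      kronecker_mult[OF cT cU cA A]
      kronecker_mult[OF mult_carrier_mat[OF cT cA] mult_carrier_mat[OF cU A] mat_adjoint_carrier[OF cT] cU'] ..
qed simp

lemma tensor_power_diag: "tensor_power (real_diag d p) n = real_diag (d ^ n) (prod_dist d p n)"
  by (induction n) (auto simp: kronecker_diag mult.commute[of d])

lemma partial_trace_carrier [simp]: "partial_trace a b A \<in> carrier_mat a a"
  by (simp add: partial_trace_def)

lemma max_mixed_carrier [simp]: "max_mixed K \<in> carrier_mat K K"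
  by (simp add: max_mixed_def)

section \<open>Invariance of rates under unitary conjugation\<close>

lemma noisy_op_carrier:
  assumes "noisy_op n m L" "X \<in> carrier_mat n n"
  shows "L X \<in> carrier_mat m m"
  using assms
  by (induction arbitrary: X) (auto simp: unitary_mat_def mat_adjoint_carrier intro!: mult_carrier_mat)

lemma conj_minus:
  assumes "U \<in> carrier_mat n n" "A \<in> carrier_mat n n" "B \<in> carrier_mat n n"
  shows "U * (A - B) * mat_adjoint U = U * A * mat_adjoint U - U * B * mat_adjoint (U :: complex mat)"
  using assms mat_adjoint_carrier[OF assms(1)]
  by (simp add: mult_minus_distrib_mat[of _ n n _ n] minus_mult_distrib_mat[of _ n n _ _ n])

lemma achievable_rate_conj:
  assumes U: "unitary_mat d U" and V: "unitary_mat e V"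
    and \<rho>: "\<rho> \<in> carrier_mat d d" and \<sigma>: "\<sigma> \<in> carrier_mat e e" and r: "achievable_rate \<rho> \<sigma> r"
  shows "achievable_rate (U * \<rho> * mat_adjoint U) (V * \<sigma> * mat_adjoint V) r"
proof -
  from r obtain m L where m: "(\<lambda>n. real (m n) / real n) \<longlonglongrightarrow> r"
    and L: "\<And>n. noisy_op (d ^ n) (e ^ m n) (L n)"
    and lim: "(\<lambda>n. trace_norm (L n (tensor_power \<rho> n) - tensor_power \<sigma> (m n))) \<longlonglongrightarrow> 0"
    using \<rho> \<sigma> unfolding achievable_rate_def by auto
  let ?U = "\<lambda>n. tensor_power U n" and ?V = "\<lambda>n. tensor_power V (m n)"
  \<comment> \<open>Undo the rotation of the input, apply the given operation, rotate the output.
    The new error is the old one conjugated by \<open>?V n\<close>, so its trace norm is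
    unchanged.\<close>
  define L' where "L' n X = ?V n * L n (mat_adjoint (?U n) * X * ?U n) * mat_adjoint (?V n)" for n X
  have Un: "unitary_mat (d ^ n) (?U n)" and Vn: "unitary_mat (e ^ m n) (?V n)" for n
    using unitary_tensor_power U V by auto
  have "noisy_op (d ^ n) (e ^ m n) (L' n)" for n
    using noisy_op.compose[OF noisy_op.compose[OF noisy_op.unitary[OF unitary_adjoint[OF Un]] L]
        noisy_op.unitary[OF Vn]]
    unfolding L'_def mat_adjoint_adjoint .
  moreover have "trace_norm (L' n (tensor_power (U * \<rho> * mat_adjoint U) n) - tensor_power (V * \<sigma> * mat_adjoint V) (m n))
     = trace_norm (L n (tensor_power \<rho> n) - tensor_power \<sigma> (m n))" for n
  proof -
    have c: "L n (tensor_power \<rho> n) \<in> carrier_mat (e ^ m n) (e ^ m n)"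
      "tensor_power \<sigma> (m n) \<in> carrier_mat (e ^ m n) (e ^ m n)"
      using noisy_op_carrier[OF L] \<rho> \<sigma> by auto
    show ?thesis
      unfolding L'_def tensor_power_conj[OF U \<rho>] tensor_power_conj[OF V \<sigma>]
        conj_cancel(1)[OF Un tensor_power_carrier[OF \<rho>]] conj_minus[OF unitary_carrier[OF Vn] c, symmetric]
      by (rule trace_norm_conj[OF Vn]) (use c in auto)
  qed
  moreover have "dim_row (U * \<rho> * mat_adjoint U) = d" "dim_row (V * \<sigma> * mat_adjoint V) = e"
    using U V by (auto simp: unitary_mat_def)
  ultimately show ?thesis
    using m lim unfolding achievable_rate_def by (intro exI[of _ m] exI[of _ L']) simp
qed

text \<open>Applying \<open>achievable_rate_conj\<close> again with the adjoint unitaries gives the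
  reverse implication, so both sides are suprema of the same set.\<close>

lemma optimal_rate_conj:
  assumes U: "unitary_mat d U" and V: "unitary_mat e V"
    and \<rho>: "\<rho> \<in> carrier_mat d d" and \<sigma>: "\<sigma> \<in> carrier_mat e e"
  shows "optimal_rate (U * \<rho> * mat_adjoint U) (V * \<sigma> * mat_adjoint V) = optimal_rate \<rho> \<sigma>"
proof -
  have c: "U * \<rho> * mat_adjoint U \<in> carrier_mat d d" "V * \<sigma> * mat_adjoint V \<in> carrier_mat e e"
    using U V \<rho> \<sigma> by (auto simp: unitary_mat_def mat_adjoint_carrier)
  have "achievable_rate (U * \<rho> * mat_adjoint U) (V * \<sigma> * mat_adjoint V) r = achievable_rate \<rho> \<sigma> r" for r
    using achievable_rate_conj[OF U V \<rho> \<sigma>]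
      achievable_rate_conj[OF unitary_adjoint[OF U] unitary_adjoint[OF V] c, unfolded mat_adjoint_adjoint
        conj_cancel(1)[OF U \<rho>] conj_cancel(1)[OF V \<sigma>]] by blast
  then have "achievable_rate (U * \<rho> * mat_adjoint U) (V * \<sigma> * mat_adjoint V) = achievable_rate \<rho> \<sigma>"
    by (rule ext)
  then show ?thesis unfolding optimal_rate_def by (simp only:)
qed

section \<open>Converse: a test on the output\<close>

lemma noisy_op_hermitian:
  assumes "noisy_op n m L" "X \<in> carrier_mat n n" "mat_adjoint X = X"
  shows "mat_adjoint (L X) = L X"
  using assms
proof (induction arbitrary: X)
  case (unitary n U)
  then show ?case by (simp add: mat_adjoint_conj[OF unitary_carrier])
next
  case (ancilla K n)
  have "mat_adjoint (max_mixed K) = max_mixed K"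
    by (rule eq_matI) (auto simp: max_mixed_def)
  then show ?case using ancilla by (simp add: kronecker_adjoint[OF _ max_mixed_carrier])
next
  case (discard a b V)
  define Y where "Y = V * X * mat_adjoint V"
  have Y: "Y \<in> carrier_mat (a * b) (a * b)" "mat_adjoint Y = Y"
    using discard by (auto simp: Y_def mat_adjoint_conj[OF unitary_carrier] unitary_mat_def mat_adjoint_carrier)
  have "cnj (Y $$ (i, j)) = Y $$ (j, i)" if "i < a * b" "j < a * b" for i j
  proof -
    have "Y $$ (j, i) = mat_adjoint Y $$ (j, i)" by (simp only: Y(2))
    then show ?thesis using Y(1) that by simp
  qed
  moreover note block_index_less[of _ a _ b]
  ultimately have "mat_adjoint (partial_trace a b Y) = partial_trace a b Y"
    by (intro eq_matI) (auto simp: partial_trace_def)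
  then show ?case by (simp add: Y_def)
next
  case (compose n m L k M)
  then show ?case using noisy_op_carrier by blast
qed

text \<open>The argument is a function on indices instead of a vector, so that slicing it along a
  tensor factor is a mere substitution such as \<open>v (i * K + k)\<close>.\<close>

definition quadratic_form :: "nat \<Rightarrow> complex mat \<Rightarrow> (nat \<Rightarrow> complex) \<Rightarrow> complex" where
  "quadratic_form n X v = (\<Sum>i<n. \<Sum>j<n. cnj (v i) * X $$ (i, j) * v j)"

definition nonneg_form :: "nat \<Rightarrow> complex mat \<Rightarrow> bool" where
  "nonneg_form n X \<longleftrightarrow> (\<forall>v. 0 \<le> Re (quadratic_form n X v))"

lemma nonneg_form_diag_entry:
  assumes "nonneg_form n X" "i < n" shows "0 \<le> Re (X $$ (i, i))"
proof -
  have "quadratic_form n X (\<lambda>j. if j = i then 1 else 0) =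
      (\<Sum>k<n. \<Sum>j<n. if k = i \<and> j = i then X $$ (k, j) else 0)"
    unfolding quadratic_form_def by (intro sum.cong refl) auto
  also have "\<dots> = (\<Sum>k<n. if k = i then X $$ (k, i) else 0)"
    using assms(2) by (intro sum.cong refl) auto
  also have "\<dots> = X $$ (i, i)" using assms(2) by simp
  finally show ?thesis using assms(1) by (metis nonneg_form_def)
qed

lemma nonneg_form_real_diag:
  assumes "\<And>i. i < n \<Longrightarrow> 0 \<le> p i" shows "nonneg_form n (real_diag n p)"
  unfolding nonneg_form_def
proof
  fix v
  have "quadratic_form n (real_diag n p) v = (\<Sum>i<n. \<Sum>j<n. if j = i then cnj (v i) * complex_of_real (p i) * v i else 0)"
    unfolding quadratic_form_def by (intro sum.cong refl) (auto simp: mat_diag_def)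
  also have "\<dots> = (\<Sum>i<n. complex_of_real (p i * (cmod (v i))\<^sup>2))"
    by (intro sum.cong refl) (simp add: complex_norm_square[unfolded of_real_power] mult_ac)
  finally show "0 \<le> Re (quadratic_form n (real_diag n p) v)"
    using assms by (auto intro!: sum_nonneg)
qed

lemma quadratic_form_matrix:
  assumes X: "X \<in> carrier_mat n n" and V: "V \<in> carrier_mat n 1"
  shows "(mat_adjoint V * (X * V)) $$ (0, 0) = quadratic_form n X (\<lambda>i. V $$ (i, 0))"
proof -
  have "(mat_adjoint V * (X * V)) $$ (0, 0) = (\<Sum>i<n. mat_adjoint V $$ (0, i) * (X * V) $$ (i, 0))"
    by (rule index_mult_mat_sum[OF mat_adjoint_carrier[OF V] mult_carrier_mat[OF X V]]) auto
  also have "\<dots> = (\<Sum>i<n. cnj (V $$ (i, 0)) * (\<Sum>j<n. X $$ (i, j) * V $$ (j, 0)))"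
    using V by (intro sum.cong refl arg_cong2[of _ _ _ _ "(*)"] index_mult_mat_sum[OF X V]) auto
  finally show ?thesis by (simp add: quadratic_form_def sum_distrib_left mult.assoc)
qed

lemma quadratic_form_conj:
  assumes U: "U \<in> carrier_mat n n" and X: "X \<in> carrier_mat n n"
  shows "\<exists>w. quadratic_form n (U * X * mat_adjoint U) v = quadratic_form n X w"
proof -
  \<comment> \<open>As a one-column matrix, \<open>v\<close> can be moved around by associativity of
    matrix multiplication. The required \<open>w\<close> is the column of
    \<open>mat_adjoint U * V\<close>.\<close>
  define V where "V = Matrix.mat n 1 (\<lambda>(i, _). v i)"
  have V: "V \<in> carrier_mat n 1" by (simp add: V_def)
  note U' = mat_adjoint_carrier[OF U] and V' = mat_adjoint_carrier[OF V]
  have UV: "mat_adjoint U * V \<in> carrier_mat n 1" by (rule mult_carrier_mat[OF U' V])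
  have XUV: "X * (mat_adjoint U * V) \<in> carrier_mat n 1" by (rule mult_carrier_mat[OF X UV])
  have "quadratic_form n (U * X * mat_adjoint U) v = quadratic_form n (U * X * mat_adjoint U) (\<lambda>i. V $$ (i, 0))"
    unfolding quadratic_form_def by (intro sum.cong refl) (auto simp: V_def)
  also have "\<dots> = (mat_adjoint V * (U * X * mat_adjoint U * V)) $$ (0, 0)"
    by (rule quadratic_form_matrix[symmetric, OF _ V]) (rule mult_carrier_mat[OF mult_carrier_mat[OF U X] U'])
  also have "U * X * mat_adjoint U * V = U * X * (mat_adjoint U * V)"
    by (rule assoc_mult_mat[OF mult_carrier_mat[OF U X] U' V])
  also have "\<dots> = U * (X * (mat_adjoint U * V))"
    by (rule assoc_mult_mat[OF U X UV])
  also have "mat_adjoint V * \<dots> = mat_adjoint V * U * (X * (mat_adjoint U * V))"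
    by (rule assoc_mult_mat[symmetric, OF V' U XUV])
  also have "mat_adjoint V * U = mat_adjoint (mat_adjoint U * V)"
    by (simp add: mat_adjoint_mult[OF U' V])
  finally show ?thesis unfolding quadratic_form_matrix[OF X UV] by blast
qed

lemma nonneg_form_conj:
  assumes "unitary_mat n U" "X \<in> carrier_mat n n" "nonneg_form n X"
  shows "nonneg_form n (U * X * mat_adjoint U)"
  using quadratic_form_conj[OF unitary_carrier[OF assms(1)] assms(2)] assms(3)
  unfolding nonneg_form_def by metis

text \<open>Since \<open>max_mixed K\<close> is diagonal, the form splits into a sum over
  \<open>k\<close> of \<open>1 / K\<close> times the form of \<open>X\<close> at the k-th slice of
  \<open>v\<close>.\<close>

lemma nonneg_form_kronecker_max_mixed:
  assumes X: "X \<in> carrier_mat n n" and pos: "nonneg_form n X"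
  shows "nonneg_form (n * K) (kronecker X (max_mixed K))"
  unfolding nonneg_form_def
proof
  fix v
  have entry: "kronecker X (max_mixed K) $$ (i * K + k, j * K + l) =
      X $$ (i, j) * (if l = k then complex_of_real (1 / real K) else 0)"
    if "i < n" "k < K" "j < n" "l < K" for i k j l
    using that by (subst kronecker_index[OF X max_mixed_carrier block_index_less block_index_less])
      (auto simp: max_mixed_def)
  have "quadratic_form (n * K) (kronecker X (max_mixed K)) v =
    (\<Sum>i<n. \<Sum>k<K. \<Sum>j<n. \<Sum>l<K. if l = k then complex_of_real (1 / real K) * (cnj (v (i * K + k)) * X $$ (i, j) * v (j * K + k)) else 0)"
    unfolding quadratic_form_def sum_div_mod
    by (intro sum.cong refl) (simp add: entry)
  also have "\<dots> = (\<Sum>i<n. \<Sum>k<K. \<Sum>j<n. complex_of_real (1 / real K) * (cnj (v (i * K + k)) * X $$ (i, j) * v (j * K + k)))"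
    by (intro sum.cong refl) simp
  also have "\<dots> = (\<Sum>k<K. complex_of_real (1 / real K) * quadratic_form n X (\<lambda>i. v (i * K + k)))"
    unfolding quadratic_form_def sum_distrib_left by (rule sum.swap)
  finally show "0 \<le> Re (quadratic_form (n * K) (kronecker X (max_mixed K)) v)"
    using pos unfolding nonneg_form_def
    by (auto simp del: of_real_divide intro!: sum_nonneg divide_nonneg_nonneg)
qed

text \<open>The form of the partial trace at \<open>v\<close> is the sum over \<open>k\<close> of
  the form of \<open>A\<close> at v \<otimes> e_k, which is the function
  \<open>?w k\<close>.\<close>

lemma nonneg_form_partial_trace:
  assumes pos: "nonneg_form (a * b) A"
  shows "nonneg_form a (partial_trace a b A)"
  unfolding nonneg_form_def
proof
  fix v :: "nat \<Rightarrow> complex"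
  let ?w = "\<lambda>k x. if x mod b = k then v (x div b) else 0"
  have "quadratic_form (a * b) A (?w k) = (\<Sum>i<a. \<Sum>j<a. cnj (v i) * A $$ (i * b + k, j * b + k) * v j)"
    if "k < b" for k
  proof -
    have "quadratic_form (a * b) A (?w k) = (\<Sum>i<a. \<Sum>m<b. \<Sum>j<a. \<Sum>l<b.
       if l = k then (if m = k then cnj (v i) * A $$ (i * b + m, j * b + l) * v j else 0) else 0)"
      unfolding quadratic_form_def sum_div_mod by (intro sum.cong refl) auto
    also have "\<dots> = (\<Sum>i<a. \<Sum>m<b. if m = k then (\<Sum>j<a. cnj (v i) * A $$ (i * b + m, j * b + k) * v j) else 0)"
      using that by (intro sum.cong refl) auto
    also have "\<dots> = (\<Sum>i<a. \<Sum>j<a. cnj (v i) * A $$ (i * b + k, j * b + k) * v j)"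
      using that by simp
    finally show ?thesis .
  qed
  then have "(\<Sum>k<b. quadratic_form (a * b) A (?w k)) =
      (\<Sum>k<b. \<Sum>i<a. \<Sum>j<a. cnj (v i) * A $$ (i * b + k, j * b + k) * v j)"
    by (intro sum.cong) auto
  also have "\<dots> = (\<Sum>i<a. \<Sum>k<b. \<Sum>j<a. cnj (v i) * A $$ (i * b + k, j * b + k) * v j)"
    by (rule sum.swap)
  also have "\<dots> = (\<Sum>i<a. \<Sum>j<a. \<Sum>k<b. cnj (v i) * A $$ (i * b + k, j * b + k) * v j)"
    by (intro sum.cong refl sum.swap)
  also have "\<dots> = quadratic_form a (partial_trace a b A) v"
    unfolding quadratic_form_def
    by (intro sum.cong refl) (simp add: partial_trace_def sum_distrib_left sum_distrib_right)
  finally have "quadratic_form a (partial_trace a b A) v = (\<Sum>k<b. quadratic_form (a * b) A (?w k))" by simp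
  then show "0 \<le> Re (quadratic_form a (partial_trace a b A) v)"
    using pos unfolding nonneg_form_def by (auto intro!: sum_nonneg)
qed

lemma noisy_op_nonneg_form:
  assumes "noisy_op n m L" "X \<in> carrier_mat n n" "nonneg_form n X"
  shows "nonneg_form m (L X)"
  using assms
proof (induction arbitrary: X)
  case (unitary n U)
  then show ?case by (intro nonneg_form_conj)
next
  case (ancilla K n)
  then show ?case by (intro nonneg_form_kronecker_max_mixed)
next
  case (discard a b V)
  then show ?case by (intro nonneg_form_partial_trace nonneg_form_conj)
next
  case (compose n m L k M)
  then show ?case using noisy_op_carrier by blast
qed

lemma mat_trace_kronecker:
  assumes "A \<in> carrier_mat n n" "B \<in> carrier_mat m m"
  shows "mat_trace (kronecker A B) = mat_trace A * mat_trace B"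
proof -
  have "mat_trace (kronecker A B) = (\<Sum>x<n * m. kronecker A B $$ (x, x))"
    using kronecker_carrier[OF assms] unfolding mat_trace_def by simp
  also have "\<dots> = (\<Sum>i<n. \<Sum>k<m. A $$ (i, i) * B $$ (k, k))"
    unfolding sum_div_mod
    by (intro sum.cong refl) (simp add: kronecker_index[OF assms block_index_less block_index_less])
  finally show ?thesis using assms unfolding mat_trace_def sum_product by simp
qed

lemma mat_trace_max_mixed: "K > 0 \<Longrightarrow> mat_trace (max_mixed K) = 1"
  by (simp add: mat_trace_def max_mixed_def)

lemma mat_trace_partial_trace:
  "A \<in> carrier_mat (a * b) (a * b) \<Longrightarrow> mat_trace (partial_trace a b A) = mat_trace A"
  unfolding mat_trace_def by (simp add: partial_trace_def sum_div_mod)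

lemma conj_carrier:
  "unitary_mat n U \<Longrightarrow> X \<in> carrier_mat n n \<Longrightarrow> U * X * mat_adjoint U \<in> carrier_mat n n"
  by (rule mult_carrier_mat[OF mult_carrier_mat[OF unitary_carrier] unitary_adjoint_carrier])

lemma noisy_op_trace:
  assumes "noisy_op n m L" "X \<in> carrier_mat n n"
  shows "mat_trace (L X) = mat_trace X"
  using assms
proof (induction arbitrary: X)
  case (unitary n U)
  then show ?case by (intro mat_trace_conj)
next
  case (ancilla K n)
  then show ?case by (simp add: mat_trace_kronecker[OF _ max_mixed_carrier] mat_trace_max_mixed)
next
  case (discard a b V)
  then show ?case by (simp add: mat_trace_partial_trace[OF conj_carrier] mat_trace_conj)
next
  case (compose n m L k M)
  then show ?case using noisy_op_carrier by metis
qed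

lemma conj_add:
  assumes "U \<in> carrier_mat n n" "A \<in> carrier_mat n n" "B \<in> carrier_mat n n"
  shows "U * (A + B) * mat_adjoint U = U * A * mat_adjoint U + U * B * mat_adjoint (U :: complex mat)"
  using assms mat_adjoint_carrier[OF assms(1)]
  by (simp add: mult_add_distrib_mat[of _ n n _ n] add_mult_distrib_mat[of _ n n _ _ n])

lemma noisy_op_add:
  assumes "noisy_op n m L" "X \<in> carrier_mat n n" "Y \<in> carrier_mat n n"
  shows "L (X + Y) = L X + L Y"
  using assms
proof (induction arbitrary: X Y)
  case (unitary n U)
  show ?case by (rule conj_add[OF unitary_carrier[OF unitary.hyps] unitary.prems])
next
  case (ancilla K n)
  show ?case
  proof (rule eq_matI)
    fix i j assume "i < dim_row (kronecker X (max_mixed K) + kronecker Y (max_mixed K))"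
      "j < dim_col (kronecker X (max_mixed K) + kronecker Y (max_mixed K))"
    then have ij: "i < n * K" "j < n * K" using ancilla by (auto simp: kronecker_def max_mixed_def)
    show "kronecker (X + Y) (max_mixed K) $$ (i, j) = (kronecker X (max_mixed K) + kronecker Y (max_mixed K)) $$ (i, j)"
      using ancilla ij div_mod_less[OF ij(1)] div_mod_less[OF ij(2)]
      by (simp add: kronecker_def max_mixed_def add_divide_distrib)
  qed (use ancilla in \<open>auto simp: kronecker_def\<close>)
next
  case (discard a b V)
  note c = conj_carrier[OF discard.hyps(3) discard.prems(1)] conj_carrier[OF discard.hyps(3) discard.prems(2)]
  show ?case
    unfolding conj_add[OF unitary_carrier[OF discard.hyps(3)] discard.prems]
    using carrier_matD[OF c(1)] carrier_matD[OF c(2)] block_index_less[of _ a _ b]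
    by (intro eq_matI) (auto simp: partial_trace_def sum.distrib)
next
  case (compose n m L k M)
  then show ?case using noisy_op_carrier by metis
qed

lemma noisy_op_dim_pos: "noisy_op n m L \<Longrightarrow> n > 0 \<Longrightarrow> m > 0"
  by (induction rule: noisy_op.induct) auto

lemma mat_diag_const: "mat_diag n (\<lambda>_. c) = c \<cdot>\<^sub>m (1\<^sub>m n :: complex mat)"
  by (rule eq_matI) (auto simp: mat_diag_def)

lemma conj_const:
  assumes U: "unitary_mat n U"
  shows "U * mat_diag n (\<lambda>_. c) * mat_adjoint U = mat_diag n (\<lambda>_. c)"
  using unitary_carrier[OF U] unitary_adjoint_carrier[OF U] U unfolding mat_diag_const
  by (simp add: mult_smult_distrib[of _ n n _ n] mult_smult_assoc_mat[of _ n n _ n] unitary_mat_def)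

text \<open>Each generator sends scalar matrices to scalar matrices, and trace preservation fixes
  the factor. Positivity of \<open>n\<close> passes to the intermediate dimension of a composition,
  where that dimension has to cancel.\<close>

lemma noisy_op_const:
  assumes "noisy_op n m L" "n > 0"
  shows "L (mat_diag n (\<lambda>_. c)) = mat_diag m (\<lambda>_. c * of_nat n / of_nat m)"
  using assms
proof (induction arbitrary: c)
  case (unitary n U)
  then show ?case by (simp add: conj_const)
next
  case (ancilla K n)
  have "max_mixed K = mat_diag K (\<lambda>_. 1 / of_nat K)"
    by (simp add: max_mixed_def mat_diag_const)
  then show ?case using ancilla by (simp add: kronecker_diag)
next
  case (discard a b V)
  have "partial_trace a b (mat_diag (a * b) (\<lambda>_. c)) = mat_diag a (\<lambda>_. c * of_nat (a * b) / of_nat a)"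
    using discard block_index_less[of _ a _ b] by (intro eq_matI) (auto simp: partial_trace_def mat_diag_def)
  then show ?case using discard by (simp only: conj_const)
next
  case (compose n m L k M)
  then show ?case using noisy_op_dim_pos[OF compose.hyps(1)] by simp
qed

text \<open>In an eigenbasis the sum over \<open>T\<close> becomes a combination of the eigenvalues;
  the weight of the k-th one is part of the squared length of a column of \<open>U\<close>, hence
  lies between 0 and 1.\<close>

lemma trace_norm_ge_diag_sum:
  assumes A: "A \<in> carrier_mat n n" "mat_adjoint A = A" and T: "T \<subseteq> {..<n}"
  shows "\<bar>\<Sum>i\<in>T. Re (A $$ (i, i))\<bar> \<le> trace_norm A"
proof -
  obtain U l where U: "unitary_mat n U" and AU: "A = U * real_diag n l * mat_adjoint U"
    using hermitian_spectral[OF A] by blast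
  note cU = unitary_carrier[OF U] unitary_adjoint_carrier[OF U]
  have diag: "Re (A $$ (i, i)) = (\<Sum>k<n. l k * (cmod (U $$ (i, k)))\<^sup>2)" if i: "i < n" for i
  proof -
    have "A $$ (i, i) = (\<Sum>k<n. (U * real_diag n l) $$ (i, k) * mat_adjoint U $$ (k, i))"
      unfolding AU by (rule index_mult_mat_sum[OF mult_carrier_mat[OF cU(1) mat_diag_dim] cU(2) i i])
    also have "\<dots> = (\<Sum>k<n. complex_of_real (l k * (cmod (U $$ (i, k)))\<^sup>2))"
      using carrier_matD[OF cU(1)] i
      by (intro sum.cong refl) (simp add: mat_diag_mult_right[OF cU(1)] complex_norm_square[unfolded of_real_power] mult_ac)
    finally show ?thesis by simp
  qed
  have col: "(\<Sum>i<n. (cmod (U $$ (i, k)))\<^sup>2) = 1" if k: "k < n" for k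
  proof -
    have "complex_of_real (\<Sum>i<n. (cmod (U $$ (i, k)))\<^sup>2) = (\<Sum>i<n. mat_adjoint U $$ (k, i) * U $$ (i, k))"
      using carrier_matD[OF cU(1)] k by (simp add: complex_norm_square[unfolded of_real_power] mult.commute)
    also have "\<dots> = (mat_adjoint U * U) $$ (k, k)"
      by (rule index_mult_mat_sum[symmetric, OF cU(2,1) k k])
    also have "\<dots> = 1" using U k by (simp add: unitary_mat_def)
    finally show ?thesis by (simp only: of_real_eq_1_iff)
  qed
  have "(\<Sum>i\<in>T. Re (A $$ (i, i))) = (\<Sum>i\<in>T. \<Sum>k<n. l k * (cmod (U $$ (i, k)))\<^sup>2)"
    using T by (intro sum.cong) (auto simp: diag)
  also have "\<dots> = (\<Sum>k<n. l k * (\<Sum>i\<in>T. (cmod (U $$ (i, k)))\<^sup>2))"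
    by (subst sum.swap) (simp add: sum_distrib_left)
  also have "\<bar>\<dots>\<bar> \<le> (\<Sum>k<n. \<bar>l k * (\<Sum>i\<in>T. (cmod (U $$ (i, k)))\<^sup>2)\<bar>)" by (rule sum_abs)
  also have "\<dots> \<le> (\<Sum>k<n. \<bar>l k\<bar>)"
  proof (rule sum_mono)
    fix k assume "k \<in> {..<n}"
    then have "(\<Sum>i\<in>T. (cmod (U $$ (i, k)))\<^sup>2) \<le> 1"
      using sum_mono2[OF _ T, of "\<lambda>i. (cmod (U $$ (i, k)))\<^sup>2"] col[of k] by simp
    then show "\<bar>l k * (\<Sum>i\<in>T. (cmod (U $$ (i, k)))\<^sup>2)\<bar> \<le> \<bar>l k\<bar>"
      by (simp add: abs_mult sum_nonneg mult_left_le)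
  qed
  finally show ?thesis unfolding AU trace_norm_spectral[OF U] .
qed

text \<open>The input is split into its part \<open>a\<close> off \<open>B\<close>, which is at most
  \<open>c\<close>, and its part \<open>b\<close> on \<open>B\<close>. The first contributes at most
  \<open>c * n / m\<close> to each diagonal entry of the output, the second at most its trace to all
  of them together, and passing from the output to \<open>q\<close> costs the trace norm of the
  difference.\<close>

lemma noisy_op_test:
  assumes L: "noisy_op n m L" and n: "n > 0"
    and p: "\<And>x. x < n \<Longrightarrow> 0 \<le> p x" and c: "\<And>x. x < n \<Longrightarrow> x \<notin> B \<Longrightarrow> p x \<le> c" "0 \<le> c"
    and B: "B \<subseteq> {..<n}" and T: "T \<subseteq> {..<m}"
  shows "(\<Sum>i\<in>T. q i) \<le> c * real n / real m * card T + (\<Sum>x\<in>B. p x)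
    + trace_norm (L (real_diag n p) - real_diag m q)"
proof -
  let ?D = "L (real_diag n p) - real_diag m q"
  have cL: "L (real_diag n f) \<in> carrier_mat m m" for f by (rule noisy_op_carrier[OF L mat_diag_dim])
  define a where "a x = (if x \<in> B then 0 else p x)" for x
  define b where "b x = (if x \<in> B then p x else 0)" for x
  have pos: "0 \<le> Re (L (real_diag n f) $$ (i, i))" if "\<And>x. x < n \<Longrightarrow> 0 \<le> f x" "i < m" for f i
    using noisy_op_nonneg_form[OF L mat_diag_dim nonneg_form_real_diag[of n f]] nonneg_form_diag_entry that by blast
  have add: "L (real_diag n (\<lambda>x. f x + g x)) = L (real_diag n f) + L (real_diag n g)" for f g
  proof -
    have "real_diag n (\<lambda>x. f x + g x) = real_diag n f + real_diag n g"
      by (rule eq_matI) (auto simp: mat_diag_def)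
    then show ?thesis using noisy_op_add[OF L mat_diag_dim mat_diag_dim] by simp
  qed
  have add_entry: "Re (L (real_diag n (\<lambda>x. f x + g x)) $$ (i, i)) =
      Re (L (real_diag n f) $$ (i, i)) + Re (L (real_diag n g) $$ (i, i))" if "i < m" for f g i
    unfolding add using that carrier_matD[OF cL[of g]] by simp
  have pab: "real_diag n p = real_diag n (\<lambda>x. a x + b x)"
    by (rule eq_matI) (auto simp: mat_diag_def a_def b_def)
  have a_le: "Re (L (real_diag n a) $$ (i, i)) \<le> c * real n / real m" if i: "i < m" for i
  proof -
    \<comment> \<open>Monotonicity is obtained from additivity and positivity: \<open>c\<close> is
      written as \<open>a x\<close> plus the nonnegative remainder \<open>c - a x\<close>.\<close>
    have "c * real n / real m = Re (L (real_diag n (\<lambda>x. a x + (c - a x))) $$ (i, i))"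
      using noisy_op_const[OF L n, of "complex_of_real c"] i by (simp add: mat_diag_def)
    also have "\<dots> = Re (L (real_diag n a) $$ (i, i)) + Re (L (real_diag n (\<lambda>x. c - a x)) $$ (i, i))"
      by (rule add_entry[OF i])
    also have "\<dots> \<ge> Re (L (real_diag n a) $$ (i, i))"
      using pos[of "\<lambda>x. c - a x" i] i c by (simp add: a_def)
    finally show ?thesis .
  qed
  have b_nonneg: "0 \<le> b x" if "x < n" for x using p that by (simp add: b_def)
  have "(\<Sum>i\<in>T. Re (L (real_diag n b) $$ (i, i))) \<le> (\<Sum>i<m. Re (L (real_diag n b) $$ (i, i)))"
    using T pos[OF b_nonneg] by (intro sum_mono2) auto
  also have "\<dots> = Re (mat_trace (L (real_diag n b)))"
    using carrier_matD[OF cL[of b]] by (simp add: mat_trace_def)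
  also have "\<dots> = (\<Sum>x<n. b x)"
    unfolding noisy_op_trace[OF L mat_diag_dim] by simp
  also have "\<dots> = (\<Sum>x\<in>B. p x)"
    using B by (simp add: b_def sum.inter_restrict[symmetric] Int_absorb1)
  finally have b_le: "(\<Sum>i\<in>T. Re (L (real_diag n b) $$ (i, i))) \<le> (\<Sum>x\<in>B. p x)" .
  have "(\<Sum>i\<in>T. Re (L (real_diag n p) $$ (i, i))) =
      (\<Sum>i\<in>T. Re (L (real_diag n a) $$ (i, i))) + (\<Sum>i\<in>T. Re (L (real_diag n b) $$ (i, i)))"
    unfolding pab sum.distrib[symmetric] using T by (intro sum.cong refl add_entry) auto
  also have "\<dots> \<le> (\<Sum>i\<in>T. c * real n / real m) + (\<Sum>x\<in>B. p x)"
    using T a_le b_le by (intro add_mono sum_mono) auto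
  finally have 1: "(\<Sum>i\<in>T. Re (L (real_diag n p) $$ (i, i))) \<le> c * real n / real m * card T + (\<Sum>x\<in>B. p x)"
    by (simp add: mult.commute)
  have cD: "?D \<in> carrier_mat m m" by (rule minus_carrier_mat) simp
  have "mat_adjoint (L (real_diag n p)) = L (real_diag n p)"
    by (rule noisy_op_hermitian[OF L mat_diag_dim mat_adjoint_diag_real])
  then have "cnj (L (real_diag n p) $$ (j, i)) = L (real_diag n p) $$ (i, j)" if "i < m" "j < m" for i j
    using that index_mat_adjoint[of i "L (real_diag n p)" j] carrier_matD[OF cL[of p]] by simp
  then have hD: "mat_adjoint ?D = ?D"
    using carrier_matD[OF cL[of p]] by (intro eq_matI) (auto simp: mat_diag_def)
  have "(\<Sum>i\<in>T. q i) = (\<Sum>i\<in>T. Re (L (real_diag n p) $$ (i, i))) - (\<Sum>i\<in>T. Re (?D $$ (i, i)))"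
    unfolding sum_subtractf[symmetric] using T carrier_matD[OF cL[of p]]
    by (intro sum.cong refl) (auto simp: mat_diag_def)
  also have "\<dots> \<le> (\<Sum>i\<in>T. Re (L (real_diag n p) $$ (i, i))) + trace_norm ?D"
    using trace_norm_ge_diag_sum[OF cD hD T] by simp
  finally show ?thesis using 1 by simp
qed

section \<open>Achievability: permutations of a diluted spectrum\<close>

text \<open>Row \<open>i\<close> picks column \<open>\<sigma> i\<close>, so conjugation reads a
  diagonal through \<open>\<sigma>\<close> itself and no inverse permutation appears.\<close>

definition perm_mat :: "nat \<Rightarrow> (nat \<Rightarrow> nat) \<Rightarrow> complex mat" where
  "perm_mat n \<sigma> = Matrix.mat n n (\<lambda>(i, j). if j = \<sigma> i then 1 else 0)"

lemma perm_mat_carrier: "perm_mat n \<sigma> \<in> carrier_mat n n"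
  by (simp add: perm_mat_def)

lemma unitary_perm_mat:
  assumes "bij_betw \<sigma> {..<n} {..<n}" shows "unitary_mat n (perm_mat n \<sigma>)"
proof (rule unitaryI[OF perm_mat_carrier])
  fix i j assume ij: "i < n" "j < n"
  have "(\<Sum>k<n. cnj (perm_mat n \<sigma> $$ (k, i)) * perm_mat n \<sigma> $$ (k, j)) =
      (\<Sum>k<n. if \<sigma> k = i then (if i = j then 1 else 0) else 0)"
    using ij by (intro sum.cong refl) (auto simp: perm_mat_def)
  also have "\<dots> = (\<Sum>k<n. if k = i then (if i = j then 1 else 0) else 0)"
    by (rule sum.reindex_bij_betw[OF assms])
  finally show "(\<Sum>k<n. cnj (perm_mat n \<sigma> $$ (k, i)) * perm_mat n \<sigma> $$ (k, j)) = (if i = j then 1 else 0)"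
    using ij by simp
qed

lemma perm_mat_conj_diag:
  assumes "bij_betw \<sigma> {..<n} {..<n}"
  shows "perm_mat n \<sigma> * mat_diag n f * mat_adjoint (perm_mat n \<sigma>) = mat_diag n (\<lambda>i. f (\<sigma> i))"
proof (rule eq_matI)
  fix i j assume "i < dim_row (mat_diag n (\<lambda>i. f (\<sigma> i)))" "j < dim_col (mat_diag n (\<lambda>i. f (\<sigma> i)))"
  then have ij: "i < n" "j < n" by (auto simp: mat_diag_def)
  have \<sigma>: "\<sigma> i < n" "\<sigma> j < n" using bij_betwE[OF assms] ij by auto
  note c = perm_mat_carrier[of n \<sigma>]
  have "(perm_mat n \<sigma> * mat_diag n f * mat_adjoint (perm_mat n \<sigma>)) $$ (i, j) =
      (\<Sum>k<n. (perm_mat n \<sigma> * mat_diag n f) $$ (i, k) * mat_adjoint (perm_mat n \<sigma>) $$ (k, j))"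
    by (rule index_mult_mat_sum[OF mult_carrier_mat[OF c mat_diag_dim] mat_adjoint_carrier[OF c] ij])
  also have "\<dots> = (\<Sum>k<n. if k = \<sigma> i then (if \<sigma> i = \<sigma> j then f (\<sigma> i) else 0) else 0)"
    unfolding mat_diag_mult_right[OF c] using ij carrier_matD[OF c]
    by (intro sum.cong refl) (auto simp: perm_mat_def)
  also have "\<dots> = (if \<sigma> i = \<sigma> j then f (\<sigma> i) else 0)" using \<sigma> by simp
  also have "\<dots> = mat_diag n (\<lambda>i. f (\<sigma> i)) $$ (i, j)"
    using ij bij_betw_imp_inj_on[OF assms] by (auto simp: mat_diag_def inj_on_eq_iff)
  finally show "(perm_mat n \<sigma> * mat_diag n f * mat_adjoint (perm_mat n \<sigma>)) $$ (i, j) = mat_diag n (\<lambda>i. f (\<sigma> i)) $$ (i, j)" .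
qed (auto simp: perm_mat_def mat_diag_def)

text \<open>Here \<open>\<sigma>\<close> sends basis vectors of the output \<open>C^a \<otimes> C^b\<close> back to those of the
  input with its ancilla of dimension \<open>K\<close>.\<close>

definition block_average :: "nat \<Rightarrow> nat \<Rightarrow> (nat \<Rightarrow> nat) \<Rightarrow> (nat \<Rightarrow> real) \<Rightarrow> nat \<Rightarrow> real" where
  "block_average K b \<sigma> p i = (\<Sum>k<b. p (\<sigma> (i * b + k) div K) / real K)"

lemma noisy_op_block_average:
  assumes dims: "n * K = a * b" "K > 0" "a > 0" "b > 0" and \<sigma>: "bij_betw \<sigma> {..<a * b} {..<a * b}"
  shows "\<exists>L. noisy_op n a L \<and> (\<forall>p. L (real_diag n p) = real_diag a (block_average K b \<sigma> p))"
proof -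
  let ?P = "perm_mat (a * b) \<sigma>"
  define L where "L X = partial_trace a b (?P * kronecker X (max_mixed K) * mat_adjoint ?P)" for X
  have "noisy_op n (a * b) (\<lambda>X. kronecker X (max_mixed K))"
    using noisy_op.ancilla[OF dims(2), of n] dims(1) by simp
  from noisy_op.compose[OF this noisy_op.discard[OF dims(3,4) unitary_perm_mat[OF \<sigma>]]]
  have "noisy_op n a L" unfolding L_def .
  moreover have "L (real_diag n p) = real_diag a (block_average K b \<sigma> p)" for p
  proof -
    have "max_mixed K = mat_diag K (\<lambda>_. 1 / of_nat K)"
      by (simp add: max_mixed_def mat_diag_const)
    then have "L (real_diag n p) =
        partial_trace a b (?P * mat_diag (a * b) (\<lambda>x. complex_of_real (p (x div K) / real K)) * mat_adjoint ?P)"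
      unfolding L_def by (simp add: kronecker_diag dims(1))
    also have "\<dots> = partial_trace a b (real_diag (a * b) (\<lambda>x. p (\<sigma> x div K) / real K))"
      unfolding perm_mat_conj_diag[OF \<sigma>] ..
    also have "\<dots> = real_diag a (block_average K b \<sigma> p)"
      using block_index_less[of _ a _ b]
      by (intro eq_matI) (auto simp: partial_trace_def mat_diag_def block_average_def)
    finally show ?thesis .
  qed
  ultimately show ?thesis by blast
qed

lemma finite_dist_block_average:
  assumes "finite_dist n p" and dims: "n * K = a * b" "K > 0" and \<sigma>: "bij_betw \<sigma> {..<a * b} {..<a * b}"
  shows "finite_dist a (block_average K b \<sigma> p)"
proof
  interpret finite_dist n p by fact
  show "0 \<le> block_average K b \<sigma> p i" if "i < a" for i
    unfolding block_average_def
  proof (intro sum_nonneg divide_nonneg_nonneg nonneg)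
    fix k assume "k \<in> {..<b}"
    then have "\<sigma> (i * b + k) < n * K"
      using bij_betwE[OF \<sigma>] block_index_less[OF that] unfolding dims(1) by auto
    then show "\<sigma> (i * b + k) div K < n" by (rule div_mod_less)
  qed simp
  have "(\<Sum>i<a. block_average K b \<sigma> p i) = (\<Sum>x<a * b. p (\<sigma> x div K) / real K)"
    unfolding block_average_def sum_div_mod ..
  also have "\<dots> = (\<Sum>x<n * K. p (x div K) / real K)"
    unfolding dims(1) by (rule sum.reindex_bij_betw[OF \<sigma>])
  also have "\<dots> = (\<Sum>i<n. p i)" unfolding sum_div_mod using dims(2) by simp
  finally show "(\<Sum>i<a. block_average K b \<sigma> p i) = 1" using sum_one by simp
qed

text \<open>Both distributions have mass 1, so the l1 distance is twice the total deficit of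
  \<open>u\<close> against \<open>v\<close>. Hence it is enough to bound an output distribution from
  below.\<close>

lemma l1_dist_le:
  assumes "finite_dist n u" "finite_dist n v"
    and "\<And>i. i < n \<Longrightarrow> v i - u i \<le> w i" "\<And>i. i < n \<Longrightarrow> 0 \<le> w i"
  shows "(\<Sum>i<n. \<bar>u i - v i\<bar>) \<le> 2 * (\<Sum>i<n. w i)"
proof -
  have "(\<Sum>i<n. \<bar>u i - v i\<bar>) \<le> (\<Sum>i<n. 2 * w i + u i - v i)"
    using assms(3,4) by (intro sum_mono) (smt (verit) lessThan_iff)
  also have "\<dots> = 2 * (\<Sum>i<n. w i)"
    using assms(1,2) by (simp add: sum.distrib sum_subtractf sum_distrib_left finite_dist_def)
  finally show ?thesis .
qed

lemma trace_norm_diff_diag: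
  "trace_norm (real_diag n u - real_diag n v) = (\<Sum>i<n. \<bar>u i - v i\<bar>)"
proof -
  have "real_diag n u - real_diag n v = real_diag n (\<lambda>i. u i - v i)"
    by (rule eq_matI) (auto simp: mat_diag_def)
  then show ?thesis by (simp only: trace_norm_diag)
qed

lemma permutation_with_image:
  assumes "A \<subseteq> {..<N}" "B \<subseteq> {..<N}" "card A = card B"
  shows "\<exists>\<sigma>. bij_betw \<sigma> {..<N} {..<N :: nat} \<and> \<sigma> ` A = B"
proof -
  have fin: "finite A" "finite B" using assms finite_subset by blast+
  obtain f where f: "bij_betw f A B"
    using finite_same_card_bij[OF fin assms(3)] by blast
  have "card ({..<N} - A) = card ({..<N} - B)"
    using assms fin by (simp add: card_Diff_subset)
  then obtain g where g: "bij_betw g ({..<N} - A) ({..<N} - B)"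
    using finite_same_card_bij[of "{..<N} - A" "{..<N} - B"] by auto
  let ?\<sigma> = "\<lambda>x. if x \<in> A then f x else g x"
  have "bij_betw ?\<sigma> (A \<union> ({..<N} - A)) (B \<union> ({..<N} - B))"
    by (rule bij_betw_disjoint_Un[OF f g]) auto
  moreover have "A \<union> ({..<N} - A) = {..<N}" "B \<union> ({..<N} - B) = {..<N}" using assms by auto
  moreover have "?\<sigma> ` A = B" using f by (auto simp: bij_betw_def)
  ultimately show ?thesis by metis
qed

definition point_mass :: "nat \<Rightarrow> real" where
  "point_mass i = (if i = 0 then 1 else 0)"

lemma finite_dist_point_mass: "n > 0 \<Longrightarrow> finite_dist n point_mass"
  by unfold_locales (auto simp: point_mass_def)

text \<open>An ancilla of dimension \<open>M\<close> gives \<open>D * M\<close> points, regrouped as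
  \<open>M\<close> blocks of size \<open>D\<close>. The diluted copy of \<open>T\<close> has
  \<open>card T * M\<close> points and so fits into block 0, whose mass becomes the probability of
  output 0.\<close>

lemma noisy_op_concentrate:
  assumes "finite_dist D q" and M: "M > 0" and T: "T \<subseteq> {..<D}" "card T * M \<le> D"
  shows "\<exists>L. noisy_op D M L \<and>
    \<bar>trace_norm (L (real_diag D q) - real_diag M point_mass)\<bar> \<le> 2 * (\<Sum>x\<in>{..<D} - T. q x)"
proof -
  interpret finite_dist D q by fact
  define T' where "T' = (\<lambda>(i, k). i * M + k) ` (T \<times> {..<M})"
  have inj: "inj_on (\<lambda>(i, k). i * M + k) (T \<times> {..<M})"
  proof (rule inj_onI, clarsimp)
    fix i k j l assume "i * M + k = j * M + l" and "k < M" "l < M"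
    then show "i = j \<and> k = l"
      by (metis div_mult_self3 div_less add.right_neutral add_left_cancel less_nat_zero_code not_gr_zero)
  qed
  have "card T' \<le> D" using card_image[OF inj] T(2) by (simp add: T'_def card_cartesian_product)
  moreover have T'sub: "T' \<subseteq> {..<M * D}"
    using T(1) block_index_less[of _ D _ M] by (auto simp: T'_def mult.commute[of M])
  moreover have "D \<le> card {..<M * D}" using M by simp
  \<comment> \<open>Block 0 holds exactly \<open>D\<close> points, so the copy of \<open>T\<close>
    is padded arbitrarily; the padding can only increase the mass of the block.\<close>
  ultimately obtain S where S: "T' \<subseteq> S" "S \<subseteq> {..<M * D}" "card S = D"
    using exists_subset_between[of T' D "{..<M * D}"] by auto
  have "{..<D} \<subseteq> {..<M * D}" using M by (auto intro: less_le_trans)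
  then obtain \<sigma> where \<sigma>: "bij_betw \<sigma> {..<M * D} {..<M * D}" and \<sigma>S: "\<sigma> ` {..<D} = S"
    using permutation_with_image[of "{..<D}" "M * D" S] S by auto
  have dims: "D * M = M * D" by simp
  obtain L where L: "noisy_op D M L" and LD: "L (real_diag D q) = real_diag M (block_average M D \<sigma> q)"
    using noisy_op_block_average[OF dims M M d_pos \<sigma>] by blast
  let ?u = "block_average M D \<sigma> q"
  have u: "finite_dist M ?u"
    by (rule finite_dist_block_average[OF assms(1) dims M \<sigma>])
  have inj\<sigma>: "inj_on \<sigma> {..<D}"
    using bij_betw_imp_inj_on[OF \<sigma>] by (rule inj_on_subset) (use \<open>{..<D} \<subseteq> {..<M * D}\<close> in auto)
  have "(\<Sum>x\<in>T. q x) = (\<Sum>x\<in>T. \<Sum>k<M. q ((x * M + k) div M) / real M)"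
    using M by (intro sum.cong refl) simp
  also have "\<dots> = (\<Sum>y\<in>T'. q (y div M) / real M)"
    unfolding T'_def sum.reindex[OF inj] sum.cartesian_product by (simp only: comp_def case_prod_unfold)
  also have "\<dots> \<le> (\<Sum>y\<in>S. q (y div M) / real M)"
  proof (rule sum_mono2)
    show "finite S" using S(2) finite_subset by blast
    fix y assume "y \<in> S - T'"
    then have "y < D * M" using S(2) by (auto simp: mult.commute)
    then show "0 \<le> q (y div M) / real M" using nonneg div_mod_less(1) by simp
  qed (use S in auto)
  also have "\<dots> = (\<Sum>k<D. q (\<sigma> k div M) / real M)"
    unfolding \<sigma>S[symmetric] sum.reindex[OF inj\<sigma>] by simp
  also have "\<dots> = ?u 0" by (simp add: block_average_def)
  finally have "(\<Sum>x\<in>T. q x) \<le> ?u 0" .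
  moreover have "(\<Sum>x\<in>{..<D} - T. q x) = 1 - (\<Sum>x\<in>T. q x)"
    using sum_diff[OF _ T(1), of q] sum_one by simp
  ultimately have u0: "1 - ?u 0 \<le> (\<Sum>x\<in>{..<D} - T. q x)" by simp
  \<comment> \<open>A deficit against \<open>point_mass\<close> is possible only at output
    0.\<close>
  let ?w = "\<lambda>i. if i = 0 then (\<Sum>x\<in>{..<D} - T. q x) else (0 :: real)"
  have "(\<Sum>i<M. \<bar>?u i - point_mass i\<bar>) \<le> 2 * (\<Sum>i<M. ?w i)"
    using u0 finite_dist.nonneg[OF u] nonneg
    by (intro l1_dist_le[OF u finite_dist_point_mass[OF M]]) (auto simp: point_mass_def intro!: sum_nonneg)
  also have "(\<Sum>i<M. ?w i) = (\<Sum>x\<in>{..<D} - T. q x)" using M by simp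
  finally have "trace_norm (L (real_diag D q) - real_diag M point_mass) \<le> 2 * (\<Sum>x\<in>{..<D} - T. q x)"
    unfolding LD trace_norm_diff_diag .
  moreover have "0 \<le> trace_norm (L (real_diag D q) - real_diag M point_mass)"
    unfolding LD trace_norm_diff_diag by (rule sum_nonneg) simp
  ultimately show ?thesis using L by (intro exI[of _ L]) simp
qed

text \<open>The pure state becomes uniform on \<open>K = D * N\<close> points, and output
  \<open>i\<close> receives about \<open>q i * K\<close> of them. The hypothesis
  \<open>q i \<le> M / D\<close> says precisely that these fit into a block of size
  \<open>b = M * N\<close>. Rounding costs at most \<open>1 / K\<close> per output, thus
  \<open>1 / N\<close> in total, so \<open>N\<close> can be chosen as large as desired.\<close>

lemma noisy_op_dilute:
  assumes "finite_dist D q" and M: "M > 0" and N: "N > 0" and T: "T \<subseteq> {..<D}"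
    and le: "\<And>x. x \<in> T \<Longrightarrow> q x \<le> real M / real D"
  shows "\<exists>L. noisy_op M D L \<and>
    \<bar>trace_norm (L (real_diag M point_mass) - real_diag D q)\<bar> \<le> 2 * ((\<Sum>x\<in>{..<D} - T. q x) + 1 / real N)"
proof -
  interpret finite_dist D q by fact
  define K where "K = D * N"
  define b where "b = M * N"
  have K: "K > 0" and b: "b > 0" using d_pos M N by (auto simp: K_def b_def)
  have dims: "M * K = D * b" by (simp add: K_def b_def)
  define c where "c i = (if i \<in> T then nat \<lfloor>q i * K\<rfloor> else 0)" for i
  have c_le: "real (c i) \<le> q i * K" if "i < D" for i
    using nonneg[OF that] by (auto simp: c_def)
  have c_le_b: "c i \<le> b" if "i < D" for i
  proof (cases "i \<in> T")
    case True
    have "real (c i) \<le> q i * K" by (rule c_le[OF that])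
    also have "\<dots> \<le> real M / real D * K" using le[OF True] by (intro mult_right_mono) auto
    also have "\<dots> = real b" using d_pos by (simp add: K_def b_def)
    finally show ?thesis by simp
  qed (simp add: c_def)
  define C where "C = (\<Union>i<D. (\<lambda>k. i * b + k) ` {..<c i})"
  have "card C \<le> (\<Sum>i<D. card ((\<lambda>k. i * b + k) ` {..<c i}))"
    unfolding C_def by (rule card_UN_le) simp
  also have "\<dots> \<le> (\<Sum>i<D. c i)"
    by (intro sum_mono order.trans[OF card_image_le]) auto
  finally have "real (card C) \<le> (\<Sum>i<D. real (c i))" by (metis of_nat_le_iff of_nat_sum)
  also have "\<dots> \<le> (\<Sum>i<D. q i * K)" by (intro sum_mono c_le) simp
  also have "\<dots> = K" by (simp add: sum_distrib_right[symmetric] sum_one)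
  finally have "card C \<le> K" by simp
  moreover have "C \<subseteq> {..<D * b}"
    using c_le_b by (fastforce simp: C_def intro: block_index_less)
  moreover have KDb: "K \<le> D * b" using M unfolding dims[symmetric] by simp
  \<comment> \<open>All \<open>K\<close> occupied points must be placed. Those left over by rounding
    and by the outputs outside \<open>T\<close> go anywhere, since only lower bounds on the output
    matter.\<close>
  ultimately obtain A where A: "C \<subseteq> A" "A \<subseteq> {..<D * b}" "card A = K"
    using exists_subset_between[of C K "{..<D * b}"] by auto
  obtain \<sigma> where \<sigma>: "bij_betw \<sigma> {..<D * b} {..<D * b}" and \<sigma>A: "\<sigma> ` A = {..<K}"
    using permutation_with_image[of A "D * b" "{..<K}"] A KDb by auto
  obtain L where L: "noisy_op M D L"
    and LD: "L (real_diag M point_mass) = real_diag D (block_average K b \<sigma> point_mass)"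
    using noisy_op_block_average[OF dims K d_pos b \<sigma>] by blast
  let ?u = "block_average K b \<sigma> point_mass"
  have u: "finite_dist D ?u"
    by (rule finite_dist_block_average[OF finite_dist_point_mass[OF M] dims K \<sigma>])
  have u_ge: "c i / real K \<le> ?u i" if i: "i < D" for i
  proof -
    have "point_mass (\<sigma> (i * b + k) div K) = 1" if "k < c i" for k
    proof -
      \<comment> \<open>The input point 0, which carries all the mass, occupies the indices below
        \<open>K\<close> once the ancilla is added.\<close>
      have "i * b + k \<in> A" using A(1) i that by (auto simp: C_def)
      then have "\<sigma> (i * b + k) < K" using \<sigma>A by auto
      then show ?thesis by (simp add: point_mass_def)
    qed
    then have "c i / real K = (\<Sum>k<c i. point_mass (\<sigma> (i * b + k) div K) / real K)" by simp
    also have "\<dots> \<le> ?u i"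
      unfolding block_average_def using c_le_b[OF i] by (intro sum_mono2) (auto simp: point_mass_def)
    finally show ?thesis .
  qed
  let ?w = "\<lambda>i. (if i \<in> T then 0 else q i) + 1 / real K"
  have "(\<Sum>i<D. \<bar>?u i - q i\<bar>) \<le> 2 * (\<Sum>i<D. ?w i)"
  proof (rule l1_dist_le[OF u assms(1)])
    fix i assume i: "i < D"
    show "0 \<le> ?w i" using nonneg[OF i] by simp
    show "q i - ?u i \<le> ?w i"
    proof (cases "i \<in> T")
      case True
      have "q i * K - 1 \<le> c i" using True nonneg[OF i] by (simp add: c_def)
      then have "(q i * K - 1) / K \<le> c i / K" by (intro divide_right_mono) auto
      then have "q i - 1 / K \<le> c i / K" using K by (simp add: diff_divide_distrib)
      then show ?thesis using u_ge[OF i] True by simp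
    next
      case False
      then show ?thesis using finite_dist.nonneg[OF u i] by (simp add: add_increasing2)
    qed
  qed
  also have "(\<Sum>i<D. ?w i) = (\<Sum>x\<in>{..<D} - T. q x) + 1 / real N"
  proof -
    have "(\<Sum>i<D. if i \<in> T then 0 else q i) = (\<Sum>i\<in>{..<D} - T. q i)"
      by (intro sum.mono_neutral_cong_right) auto
    then show ?thesis using d_pos by (simp add: sum.distrib K_def)
  qed
  finally have "trace_norm (L (real_diag M point_mass) - real_diag D q) \<le>
      2 * ((\<Sum>x\<in>{..<D} - T. q x) + 1 / real N)"
    unfolding LD trace_norm_diff_diag .
  moreover have "0 \<le> trace_norm (L (real_diag M point_mass) - real_diag D q)"
    unfolding LD trace_norm_diff_diag by (rule sum_nonneg) simp
  ultimately show ?thesis using L by (intro exI[of _ L]) simp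
qed

section \<open>Asymptotics\<close>

lemma tensor_power_point_mass: "tensor_power (real_diag 2 point_mass) n = real_diag (2 ^ n) point_mass"
proof -
  have "prod_dist 2 point_mass n x = point_mass x" if "x < 2 ^ n" for x
    using that
  proof (induction n arbitrary: x)
    case (Suc n)
    have "x div 2 < 2 ^ n" using Suc.prems by (simp add: less_mult_imp_div_less)
    then have "prod_dist 2 point_mass (Suc n) x = point_mass (x div 2) * point_mass (x mod 2)"
      using Suc.IH by simp
    also have "\<dots> = point_mass x" by (auto simp: point_mass_def)
    finally show ?case .
  qed (simp add: point_mass_def)
  then show ?thesis unfolding tensor_power_diag by (intro eq_matI) (auto simp: mat_diag_def)
qed

lemma floor_rate_tendsto:
  assumes "r \<ge> 0" shows "(\<lambda>n. real (nat \<lfloor>real n * r\<rfloor>) / real n) \<longlonglongrightarrow> r"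
proof (rule tendsto_sandwich)
  have *: "real n * r - 1 \<le> real (nat \<lfloor>real n * r\<rfloor>)" "real (nat \<lfloor>real n * r\<rfloor>) \<le> real n * r" for n
    using assms by (auto simp: of_nat_nat)
  show "\<forall>\<^sub>F n in sequentially. r - 1 / real n \<le> real (nat \<lfloor>real n * r\<rfloor>) / real n"
    using eventually_gt_at_top[of 0]
  proof eventually_elim
    case (elim n)
    have "(real n * r - 1) / real n \<le> real (nat \<lfloor>real n * r\<rfloor>) / real n"
      by (intro divide_right_mono *) simp
    then show ?case using elim by (simp add: diff_divide_distrib)
  qed
  show "\<forall>\<^sub>F n in sequentially. real (nat \<lfloor>real n * r\<rfloor>) / real n \<le> r"
    using eventually_gt_at_top[of 0]
  proof eventually_elim
    case (elim n)
    then show ?case using *(2)[of n] by (simp add: divide_le_eq mult.commute)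
  qed
  show "(\<lambda>n. r - 1 / real n) \<longlonglongrightarrow> r"
    using tendsto_diff[OF tendsto_const lim_1_over_n, of r] by simp
qed simp

text \<open>When rho is the target, its tails are taken at length \<open>m n\<close>; they vanish
  only if \<open>m n\<close> tends to infinity, which a positive rate guarantees.\<close>

lemma nat_rate_at_top:
  assumes "(\<lambda>n. real (m n) / real n) \<longlonglongrightarrow> r" "r > 0"
  shows "filterlim m at_top sequentially"
proof -
  have "filterlim (\<lambda>n. real (m n) / real n * real n) at_top sequentially"
    by (rule filterlim_tendsto_pos_mult_at_top[OF assms filterlim_real_sequentially])
  moreover have "\<forall>\<^sub>F n in sequentially. real (m n) / real n * real n = real (m n)"
    using eventually_gt_at_top[of 0] by eventually_elim simp
  ultimately have "filterlim (\<lambda>n. real (m n)) at_top sequentially"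
    by (simp add: filterlim_cong)
  then show ?thesis
    unfolding filterlim_at_top by (metis (mono_tags, lifting) eventually_mono of_nat_le_iff)
qed

text \<open>Both converses yield \<open>1 - \<epsilon> n \<le> 2 powr x\<close> with
  \<open>x\<close> linear in \<open>n\<close> and \<open>m n\<close>. Once the error is below one
  half this costs one unit in the exponent, which disappears after division by
  \<open>n\<close>.\<close>

lemma powr_gt_half:
  assumes "1 - \<epsilon> \<le> 2 powr x" "\<epsilon> < 1 / 2" shows "- 1 \<le> (x :: real)"
proof (rule ccontr)
  assume "\<not> - 1 \<le> x"
  then have "2 powr x \<le> 2 powr (- 1)" by (intro powr_mono) auto
  then show False using assms by (simp add: powr_minus)
qed

text \<open>The absolute value around \<open>trace_norm\<close> allows the limit to be obtained by
  squeezing without a general proof that the trace norm is nonnegative; for the diagonal differences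
  at hand it is a sum of absolute values.\<close>

lemma achievable_rateI:
  assumes \<rho>: "\<rho> \<in> carrier_mat d d" and \<sigma>: "\<sigma> \<in> carrier_mat e e"
    and m: "(\<lambda>n. real (m n) / real n) \<longlonglongrightarrow> r"
    and L: "\<And>n. \<exists>L. noisy_op (d ^ n) (e ^ m n) L \<and>
      \<bar>trace_norm (L (tensor_power \<rho> n) - tensor_power \<sigma> (m n))\<bar> \<le> \<epsilon> n"
    and \<epsilon>: "\<epsilon> \<longlonglongrightarrow> 0"
  shows "achievable_rate \<rho> \<sigma> r"
proof -
  obtain L where L: "\<And>n. noisy_op (d ^ n) (e ^ m n) (L n)"
    "\<And>n. \<bar>trace_norm (L n (tensor_power \<rho> n) - tensor_power \<sigma> (m n))\<bar> \<le> \<epsilon> n"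
    using L by metis
  have "(\<lambda>n. trace_norm (L n (tensor_power \<rho> n) - tensor_power \<sigma> (m n))) \<longlonglongrightarrow> 0"
    by (rule tendsto_rabs_zero_cancel, rule tendsto_sandwich[OF _ _ tendsto_const \<epsilon>]) (use L(2) in auto)
  then show ?thesis
    using m L(1) carrier_matD(1)[OF \<rho>] carrier_matD(1)[OF \<sigma>] unfolding achievable_rate_def by blast
qed

lemma achievable_rateE:
  assumes "achievable_rate \<rho> \<sigma> r" "\<rho> \<in> carrier_mat d d" "\<sigma> \<in> carrier_mat e e"
  obtains m L where "(\<lambda>n. real (m n) / real n) \<longlonglongrightarrow> r"
    "\<And>n. noisy_op (d ^ n) (e ^ m n) (L n)"
    "(\<lambda>n. trace_norm (L n (tensor_power \<rho> n) - tensor_power \<sigma> (m n))) \<longlonglongrightarrow> 0"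
  using assms carrier_matD(1)[OF assms(2)] carrier_matD(1)[OF assms(3)]
  unfolding achievable_rate_def by blast

section \<open>Rates between a pure qubit and a diagonal state\<close>

context finite_dist
begin

definition negentropy :: real where
  "negentropy = log 2 d - entropy"

lemma power_eq_powr: "real (d ^ n) = 2 powr (n * log 2 d)"
proof -
  have "2 powr (n * log 2 d) = (2 powr log 2 d) powr n" by (simp only: powr_powr mult.commute)
  then show ?thesis using d_pos by (simp add: powr_realpow)
qed

definition low_set :: "real \<Rightarrow> nat \<Rightarrow> nat set" where
  "low_set \<delta> n = {x. x < d ^ n \<and> prod_dist d p n x < 2 powr (- (real n * (entropy + \<delta>)))}"

definition high_set :: "real \<Rightarrow> nat \<Rightarrow> nat set" where
  "high_set \<delta> n = {x. x < d ^ n \<and> 2 powr (- (real n * (entropy - \<delta>))) < prod_dist d p n x}"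

lemma card_not_low_set: "real (card ({..<d ^ n} - low_set \<delta> n)) \<le> 2 powr (n * (entropy + \<delta>))"
proof -
  interpret n: finite_dist "d ^ n" "prod_dist d p n" by (rule finite_dist_prod_dist)
  have "{..<d ^ n} - low_set \<delta> n = {x. x < d ^ n \<and> 2 powr (- (real n * (entropy + \<delta>))) \<le> prod_dist d p n x}"
    by (auto simp: low_set_def)
  then show ?thesis using n.card_ge_le[of "2 powr (- (real n * (entropy + \<delta>)))"]
    by (simp add: powr_minus_divide)
qed

lemma sum_low_set: "(\<Sum>x\<in>low_set \<delta> n. prod_dist d p n x) = low_tail \<delta> n"
  by (simp add: low_set_def low_tail_def)

lemma sum_high_set: "(\<Sum>x\<in>high_set \<delta> n. prod_dist d p n x) = high_tail \<delta> n"
  by (simp add: high_set_def high_tail_def)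

lemma rate_to_pure_le:
  assumes "achievable_rate (real_diag d p) (real_diag 2 point_mass) r"
  shows "r \<le> negentropy"
proof (rule field_le_epsilon)
  fix \<delta> :: real assume \<delta>: "\<delta> > 0"
  obtain m L where m: "(\<lambda>n. real (m n) / real n) \<longlonglongrightarrow> r"
    and L: "\<And>n. noisy_op (d ^ n) (2 ^ m n) (L n)"
    and lim: "(\<lambda>n. trace_norm (L n (tensor_power (real_diag d p) n) - tensor_power (real_diag 2 point_mass) (m n))) \<longlonglongrightarrow> 0"
    using achievable_rateE[OF assms mat_diag_dim mat_diag_dim] by blast
  define \<epsilon> where "\<epsilon> n = high_tail \<delta> n +
    trace_norm (L n (real_diag (d ^ n) (prod_dist d p n)) - real_diag (2 ^ m n) point_mass)" for n
  have \<epsilon>: "\<epsilon> \<longlonglongrightarrow> 0"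
    using tendsto_add[OF high_tail_tendsto[OF \<delta>] lim]
    unfolding \<epsilon>_def tensor_power_diag[symmetric] tensor_power_point_mass[symmetric] by simp
  have bound: "1 - \<epsilon> n \<le> 2 powr (n * (negentropy + \<delta>) - m n)" for n
  proof -
    \<comment> \<open>The test is the target's only basis vector of nonzero weight; the atypically
      large probabilities are charged to the tail.\<close>
    have "(\<Sum>i\<in>{0}. point_mass i) \<le> 2 powr (- (real n * (entropy - \<delta>))) * real (d ^ n) / real (2 ^ m n) * card {0 :: nat}
        + (\<Sum>x\<in>high_set \<delta> n. prod_dist d p n x)
        + trace_norm (L n (real_diag (d ^ n) (prod_dist d p n)) - real_diag (2 ^ m n) point_mass)"
      by (rule noisy_op_test[OF L]) (use d_pos prod_dist_nonneg in \<open>auto simp: high_set_def\<close>)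
    then have "1 - \<epsilon> n \<le> 2 powr (- (real n * (entropy - \<delta>))) * real (d ^ n) / real (2 ^ m n)"
      by (simp add: \<epsilon>_def sum_high_set point_mass_def)
    also have "\<dots> = 2 powr (- (real n * (entropy - \<delta>)) + n * log 2 d - m n)"
      unfolding power_eq_powr powr_add powr_diff by (simp add: powr_realpow)
    also have "- (real n * (entropy - \<delta>)) + n * log 2 d - m n = n * (negentropy + \<delta>) - m n"
      by (simp add: negentropy_def algebra_simps)
    finally show ?thesis .
  qed
  have half: "\<forall>\<^sub>F n in sequentially. \<epsilon> n < 1 / 2"
    using order_tendstoD(2)[OF \<epsilon>, of "1 / 2"] by simp
  have "\<forall>\<^sub>F n in sequentially. real (m n) / real n \<le> negentropy + \<delta> + 1 / real n"
    using half eventually_gt_at_top[of 0]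
  proof eventually_elim
    case (elim n)
    then have "-1 \<le> n * (negentropy + \<delta>) - m n" using powr_gt_half[OF bound] by simp
    then have "m n / n \<le> (n * (negentropy + \<delta>) + 1) / n" by (intro divide_right_mono) auto
    then show ?case using elim by (simp add: add_divide_distrib)
  qed
  moreover have "(\<lambda>n. negentropy + \<delta> + 1 / real n) \<longlonglongrightarrow> negentropy + \<delta>"
    using tendsto_add[OF tendsto_const lim_1_over_n, of "negentropy + \<delta>"] by simp
  ultimately show "r \<le> negentropy + \<delta>"
    using tendsto_le[OF sequentially_bot _ m] by blast
qed

lemma rate_from_pure_le:
  assumes "achievable_rate (real_diag 2 point_mass) (real_diag d p) r" and r: "r > 0"
  shows "r * negentropy \<le> 1"
proof (rule field_le_epsilon)
  fix e :: real assume e: "e > 0"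
  \<comment> \<open>The margin in the entropy is multiplied by the rate \<open>r\<close> in the
    limit, and \<open>r * \<delta>\<close> has to be \<open>e\<close>.\<close>
  define \<delta> where "\<delta> = e / r"
  have \<delta>: "\<delta> > 0" using e r by (simp add: \<delta>_def)
  obtain m L where m: "(\<lambda>n. real (m n) / real n) \<longlonglongrightarrow> r"
    and L: "\<And>n. noisy_op (2 ^ n) (d ^ m n) (L n)"
    and lim: "(\<lambda>n. trace_norm (L n (tensor_power (real_diag 2 point_mass) n) - tensor_power (real_diag d p) (m n))) \<longlonglongrightarrow> 0"
    using achievable_rateE[OF assms(1) mat_diag_dim mat_diag_dim] by blast
  define \<epsilon> where "\<epsilon> n = low_tail \<delta> (m n) +
    trace_norm (L n (real_diag (2 ^ n) point_mass) - real_diag (d ^ m n) (prod_dist d p (m n)))" for n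
  have "(\<lambda>n. low_tail \<delta> (m n)) \<longlonglongrightarrow> 0"
    using filterlim_compose[OF low_tail_tendsto[OF \<delta>] nat_rate_at_top[OF m r]] .
  from tendsto_add[OF this lim] have \<epsilon>: "\<epsilon> \<longlonglongrightarrow> 0"
    unfolding \<epsilon>_def tensor_power_diag[symmetric] tensor_power_point_mass[symmetric] by simp
  have bound: "1 - \<epsilon> n \<le> 2 powr (n - m n * (negentropy - \<delta>))" for n
  proof -
    let ?T = "{..<d ^ m n} - low_set \<delta> (m n)"
    have "(\<Sum>x\<in>?T. prod_dist d p (m n) x) = 1 - low_tail \<delta> (m n)"
      using sum_diff[of "{..<d ^ m n}" "low_set \<delta> (m n)" "prod_dist d p (m n)"]
      by (simp add: prod_dist_sum sum_low_set) (auto simp: low_set_def)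
    \<comment> \<open>A pure input is bounded by \<open>c = 1\<close> everywhere, so nothing is cut
      off. The test keeps the target points whose probability is not too small, of which there are
      few.\<close>
    moreover have "(\<Sum>x\<in>?T. prod_dist d p (m n) x) \<le> 1 * real (2 ^ n) / real (d ^ m n) * card ?T + (\<Sum>x\<in>{}. point_mass x)
        + trace_norm (L n (real_diag (2 ^ n) point_mass) - real_diag (d ^ m n) (prod_dist d p (m n)))"
      by (rule noisy_op_test[OF L]) (auto simp: point_mass_def)
    ultimately have "1 - \<epsilon> n \<le> real (2 ^ n) / real (d ^ m n) * card ?T"
      by (simp add: \<epsilon>_def)
    also have "\<dots> \<le> real (2 ^ n) / real (d ^ m n) * 2 powr (m n * (entropy + \<delta>))"
      by (intro mult_left_mono card_not_low_set) simp
    also have "\<dots> = 2 powr (n - m n * log 2 d + m n * (entropy + \<delta>))"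
      unfolding power_eq_powr powr_add powr_diff by (simp add: powr_realpow)
    also have "n - m n * log 2 d + m n * (entropy + \<delta>) = n - m n * (negentropy - \<delta>)"
      by (simp add: negentropy_def algebra_simps)
    finally show ?thesis .
  qed
  have half: "\<forall>\<^sub>F n in sequentially. \<epsilon> n < 1 / 2"
    using order_tendstoD(2)[OF \<epsilon>, of "1 / 2"] by simp
  have "\<forall>\<^sub>F n in sequentially. real (m n) / real n * (negentropy - \<delta>) \<le> 1 + 1 / real n"
    using half eventually_gt_at_top[of 0]
  proof eventually_elim
    case (elim n)
    then have "-1 \<le> n - m n * (negentropy - \<delta>)" using powr_gt_half[OF bound] by simp
    then have "m n * (negentropy - \<delta>) / n \<le> (n + 1) / n" by (intro divide_right_mono) auto
    then show ?case using elim by (simp add: add_divide_distrib)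
  qed
  moreover have "(\<lambda>n. 1 + 1 / real n) \<longlonglongrightarrow> 1"
    using tendsto_add[OF tendsto_const lim_1_over_n, of 1] by simp
  moreover have "(\<lambda>n. real (m n) / real n * (negentropy - \<delta>)) \<longlonglongrightarrow> r * (negentropy - \<delta>)"
    by (intro tendsto_intros m)
  ultimately have "r * (negentropy - \<delta>) \<le> 1"
    using tendsto_le[OF sequentially_bot] by blast
  then show "r * negentropy \<le> 1 + e" using r by (simp add: \<delta>_def algebra_simps)
qed

text \<open>For \<open>m = 0\<close> the target space is one-dimensional and discarding everything
  is exact. With the converse this shows I \<ge> 0, and it settles the case I = 0, where
  \<open>rate_to_pure_ge\<close> is vacuous.\<close>

lemma rate_to_pure_zero: "achievable_rate (real_diag d p) (real_diag 2 point_mass) 0"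
proof (rule achievable_rateI[OF mat_diag_dim mat_diag_dim, where m = "\<lambda>_. 0" and \<epsilon> = "\<lambda>_. 0"])
  show "\<exists>L. noisy_op (d ^ n) (2 ^ 0) L \<and> \<bar>trace_norm (L (tensor_power (real_diag d p) n) -
      tensor_power (real_diag 2 point_mass) 0)\<bar> \<le> 0" for n
    using noisy_op_concentrate[OF finite_dist_prod_dist[of n], of "2 ^ 0" "{..<d ^ n}"]
    unfolding tensor_power_point_mass unfolding tensor_power_diag by simp
qed auto

lemma rate_to_pure_ge:
  assumes "0 \<le> r" "r < negentropy"
  shows "achievable_rate (real_diag d p) (real_diag 2 point_mass) r"
proof -
  \<comment> \<open>With this margin \<open>entropy + \<delta> + r = log 2 d\<close>, so the bound
    on the diluted typical set is exactly the block size \<open>d ^ n\<close>.\<close>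
  define \<delta> where "\<delta> = negentropy - r"
  define m where "m n = nat \<lfloor>real n * r\<rfloor>" for n
  have \<delta>: "\<delta> > 0" using assms by (simp add: \<delta>_def)
  show ?thesis
  proof (rule achievable_rateI[OF mat_diag_dim mat_diag_dim, of m])
    show "(\<lambda>n. real (m n) / real n) \<longlonglongrightarrow> r" unfolding m_def by (rule floor_rate_tendsto[OF assms(1)])
    show "(\<lambda>n. 2 * low_tail \<delta> n) \<longlonglongrightarrow> 0"
      using tendsto_mult_right_zero[OF low_tail_tendsto[OF \<delta>]] .
    fix n
    let ?T = "{..<d ^ n} - low_set \<delta> n"
    have "real (card ?T) * real (2 ^ m n) \<le> 2 powr (n * (entropy + \<delta>)) * 2 powr (n * r)"
    proof (intro mult_mono card_not_low_set)
      have "real (2 ^ m n) = 2 powr (m n)" by (simp add: powr_realpow)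
      also have "\<dots> \<le> 2 powr (n * r)" using assms(1) by (intro powr_mono) (auto simp: m_def)
      finally show "real (2 ^ m n) \<le> 2 powr (n * r)" .
    qed auto
    also have "\<dots> = real (d ^ n)"
      unfolding power_eq_powr powr_add[symmetric] by (simp add: \<delta>_def negentropy_def algebra_simps)
    finally have "card ?T * 2 ^ m n \<le> d ^ n" by (metis of_nat_le_iff of_nat_mult)
    from noisy_op_concentrate[OF finite_dist_prod_dist _ _ this]
    obtain L where "noisy_op (d ^ n) (2 ^ m n) L"
      "\<bar>trace_norm (L (real_diag (d ^ n) (prod_dist d p n)) - real_diag (2 ^ m n) point_mass)\<bar> \<le>
        2 * (\<Sum>x\<in>{..<d ^ n} - ?T. prod_dist d p n x)" by auto
    moreover have "{..<d ^ n} - ?T = low_set \<delta> n" by (auto simp: low_set_def)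
    ultimately show "\<exists>L. noisy_op (d ^ n) (2 ^ m n) L \<and> \<bar>trace_norm (L (tensor_power (real_diag d p) n) -
        tensor_power (real_diag 2 point_mass) (m n))\<bar> \<le> 2 * low_tail \<delta> n"
      unfolding tensor_power_point_mass unfolding tensor_power_diag by (auto simp: sum_low_set)
  qed
qed

lemma rate_from_pure_ge:
  assumes "0 < r" "r * negentropy < 1"
  shows "achievable_rate (real_diag 2 point_mass) (real_diag d p) r"
proof -
  \<comment> \<open>With this margin \<open>entropy - \<delta> = log 2 d - 1 / r\<close>. A typical
    probability is then at most \<open>2 powr (m n / r) / d ^ m n\<close>, and
    \<open>m n \<le> n * r\<close> brings it below the capacity \<open>2 ^ n / d ^ m n\<close> of a
    block.\<close>
  define \<delta> where "\<delta> = 1 / r - negentropy"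
  define m where "m n = nat \<lfloor>real n * r\<rfloor>" for n
  have \<delta>: "\<delta> > 0" using assms by (simp add: \<delta>_def field_simps)
  have m: "(\<lambda>n. real (m n) / real n) \<longlonglongrightarrow> r" unfolding m_def using assms(1) by (intro floor_rate_tendsto) simp
  show ?thesis
  proof (rule achievable_rateI[OF mat_diag_dim mat_diag_dim m])
    have "(\<lambda>n. high_tail \<delta> (m n)) \<longlonglongrightarrow> 0"
      using filterlim_compose[OF high_tail_tendsto[OF \<delta>] nat_rate_at_top[OF m assms(1)]] .
    \<comment> \<open>The resolution \<open>N\<close> of \<open>noisy_op_dilute\<close> is taken to
      be \<open>Suc n\<close>, so that it is positive and the rounding error tends to 0.\<close>
    from tendsto_mult_right_zero[OF tendsto_add_zero[OF this LIMSEQ_inverse_real_of_nat]]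
    show "(\<lambda>n. 2 * (high_tail \<delta> (m n) + 1 / real (Suc n))) \<longlonglongrightarrow> 0"
      unfolding inverse_eq_divide .
    fix n
    let ?T = "{..<d ^ m n} - high_set \<delta> (m n)"
    have le: "prod_dist d p (m n) x \<le> real (2 ^ n) / real (d ^ m n)" if "x \<in> ?T" for x
    proof -
      have "prod_dist d p (m n) x \<le> 2 powr (- (m n * (entropy - \<delta>)))"
        using that by (auto simp: high_set_def)
      also have "- (m n * (entropy - \<delta>)) = m n / r - m n * log 2 d"
        by (simp add: \<delta>_def negentropy_def algebra_simps)
      also have "2 powr (m n / r - m n * log 2 d) \<le> 2 powr (n - m n * log 2 d)"
      proof (rule powr_mono)
        have "real (m n) \<le> n * r" using assms(1) by (simp add: m_def)
        then show "m n / r - m n * log 2 d \<le> n - m n * log 2 d" using assms(1) by (simp add: field_simps)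
      qed simp
      also have "\<dots> = real (2 ^ n) / real (d ^ m n)"
        unfolding power_eq_powr powr_diff by (simp add: powr_realpow)
      finally show ?thesis .
    qed
    have "\<exists>L. noisy_op (2 ^ n) (d ^ m n) L \<and>
      \<bar>trace_norm (L (real_diag (2 ^ n) point_mass) - real_diag (d ^ m n) (prod_dist d p (m n)))\<bar> \<le>
        2 * ((\<Sum>x\<in>{..<d ^ m n} - ?T. prod_dist d p (m n) x) + 1 / real (Suc n))"
      by (rule noisy_op_dilute[OF finite_dist_prod_dist _ _ _ le]) auto
    then obtain L where "noisy_op (2 ^ n) (d ^ m n) L"
      "\<bar>trace_norm (L (real_diag (2 ^ n) point_mass) - real_diag (d ^ m n) (prod_dist d p (m n)))\<bar> \<le>
        2 * ((\<Sum>x\<in>{..<d ^ m n} - ?T. prod_dist d p (m n) x) + 1 / real (Suc n))" by blast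
    moreover have "{..<d ^ m n} - ?T = high_set \<delta> (m n)" by (auto simp: high_set_def)
    ultimately show "\<exists>L. noisy_op (2 ^ n) (d ^ m n) L \<and> \<bar>trace_norm (L (tensor_power (real_diag 2 point_mass) n) -
        tensor_power (real_diag d p) (m n))\<bar> \<le> 2 * (high_tail \<delta> (m n) + 1 / real (Suc n))"
      unfolding tensor_power_point_mass unfolding tensor_power_diag by (auto simp only: sum_high_set)
  qed
qed

theorem optimal_rate_to_pure:
  "optimal_rate (real_diag d p) (real_diag 2 point_mass) = ereal negentropy"
  unfolding optimal_rate_def
proof (rule antisym)
  let ?S = "ereal ` {r. achievable_rate (real_diag d p) (real_diag 2 point_mass) r}"
  show "Sup ?S \<le> ereal negentropy"
    by (rule Sup_least) (auto dest: rate_to_pure_le)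
  \<comment> \<open>Nonnegativity of I follows from the converse bound applied to the rate
    0.\<close>
  have "negentropy \<ge> 0" using rate_to_pure_le[OF rate_to_pure_zero] .
  show "ereal negentropy \<le> Sup ?S"
  proof (cases "negentropy = 0")
    case True
    then show ?thesis using rate_to_pure_zero by (intro Sup_upper) auto
  next
    case False
    show ?thesis
    proof (rule dense_le)
      fix x assume x: "x < ereal negentropy"
      then obtain y where y: "x < ereal y" "y < negentropy"
        using ereal_dense2[of x "ereal negentropy"] by auto
      have "achievable_rate (real_diag d p) (real_diag 2 point_mass) (max 0 y)"
        using rate_to_pure_ge[of "max 0 y"] y(2) False \<open>negentropy \<ge> 0\<close> by simp
      then have "ereal (max 0 y) \<le> Sup ?S" by (intro Sup_upper imageI CollectI)
      moreover have "x \<le> ereal (max 0 y)" using y(1) by (simp add: less_le_trans max.coboundedI2 order.strict_implies_order)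
      ultimately show "x \<le> Sup ?S" by (rule order.trans[rotated])
    qed
  qed
qed

theorem optimal_rate_from_pure:
  assumes "negentropy > 0"
  shows "optimal_rate (real_diag 2 point_mass) (real_diag d p) = ereal (1 / negentropy)"
  unfolding optimal_rate_def
proof (rule antisym)
  let ?S = "ereal ` {r. achievable_rate (real_diag 2 point_mass) (real_diag d p) r}"
  have "r \<le> 1 / negentropy" if "achievable_rate (real_diag 2 point_mass) (real_diag d p) r" for r
  proof (cases "r > 0")
    case True
    then show ?thesis using rate_from_pure_le[OF that True] assms by (simp add: field_simps)
  next
    case False
    then have "r \<le> 0" by simp
    also have "0 \<le> 1 / negentropy" using assms by simp
    finally show ?thesis .
  qed
  then show "Sup ?S \<le> ereal (1 / negentropy)" by (intro Sup_least) auto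
  show "ereal (1 / negentropy) \<le> Sup ?S"
  proof (rule dense_le)
    fix x assume "x < ereal (1 / negentropy)"
    \<comment> \<open>Starting from \<open>max 0 x\<close> makes the intermediate rate
      \<open>y\<close> positive, as \<open>rate_from_pure_ge\<close> demands.\<close>
    then have "max 0 x < ereal (1 / negentropy)" using assms by simp
    then obtain y where y: "max 0 x < ereal y" "y < 1 / negentropy"
      using ereal_dense2[of "max 0 x" "ereal (1 / negentropy)"] by auto
    then have "0 < y" "x \<le> ereal y" by auto
    then have "achievable_rate (real_diag 2 point_mass) (real_diag d p) y"
      using y(2) assms by (intro rate_from_pure_ge) (auto simp: field_simps)
    then have "ereal y \<le> Sup ?S" by (intro Sup_upper) auto
    then show "x \<le> Sup ?S" using \<open>x \<le> ereal y\<close> by simp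
  qed
qed

end

section \<open>From diagonal states to arbitrary ones\<close>

lemma pure_qubit_diag:
  assumes "pure_state 2 \<pi>"
  shows "\<exists>V. unitary_mat 2 V \<and> \<pi> = V * real_diag 2 point_mass * mat_adjoint V"
proof -
  obtain \<psi> where \<psi>: "\<psi> \<in> carrier_vec 2" "\<psi> \<bullet>c \<psi> = 1"
    and \<pi>: "\<pi> = Matrix.mat 2 2 (\<lambda>(i, j). \<psi> $ i * conjugate (\<psi> $ j))"
    using assms unfolding pure_state_def by blast
  define a b where "a = \<psi> $ 0" and "b = \<psi> $ Suc 0"
  have norm: "a * cnj a + b * cnj b = 1"
    using \<psi> by (simp add: scalar_prod_def a_def b_def numeral_2_eq_2)
  \<comment> \<open>The first column is the given unit vector (a, b); the second, (-cnj b, cnj a),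
    is the unit vector orthogonal to it, unique up to a phase.\<close>
  define V where "V = Matrix.mat 2 2 (\<lambda>(i, j). if j = 0 then \<psi> $ i else if i = 0 then - cnj b else cnj a)"
  have cV: "V \<in> carrier_mat 2 2" by (simp add: V_def)
  have "unitary_mat 2 V"
  proof (rule unitaryI[OF cV])
    fix i j :: nat assume "i < 2" "j < 2"
    then have "i = 0 \<or> i = 1" "j = 0 \<or> j = 1" by auto
    then show "(\<Sum>k<2. cnj (V $$ (k, i)) * V $$ (k, j)) = (if i = j then 1 else 0)"
      using norm by (auto simp: V_def a_def[symmetric] b_def[symmetric] numeral_2_eq_2 algebra_simps)
  qed
  moreover have "\<pi> = V * real_diag 2 point_mass * mat_adjoint V"
  proof (rule eq_matI)
    fix i j assume "i < dim_row (V * real_diag 2 point_mass * mat_adjoint V)"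
      "j < dim_col (V * real_diag 2 point_mass * mat_adjoint V)"
    then have ij: "i < 2" "j < 2" using cV by auto
    have "(V * real_diag 2 point_mass * mat_adjoint V) $$ (i, j) =
        (\<Sum>k<2. (V * real_diag 2 point_mass) $$ (i, k) * mat_adjoint V $$ (k, j))"
      by (rule index_mult_mat_sum[OF mult_carrier_mat[OF cV mat_diag_dim] mat_adjoint_carrier[OF cV] ij])
    also have "\<dots> = (\<Sum>k<2. V $$ (i, k) * point_mass k * cnj (V $$ (j, k)))"
      unfolding mat_diag_mult_right[OF cV] using ij carrier_matD[OF cV] by (intro sum.cong refl) auto
    also have "\<dots> = \<psi> $ i * cnj (\<psi> $ j)"
      using ij by (simp add: numeral_2_eq_2 V_def point_mass_def)
    finally show "\<pi> $$ (i, j) = (V * real_diag 2 point_mass * mat_adjoint V) $$ (i, j)"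
      using ij by (simp add: \<pi>)
  qed (use cV in \<open>auto simp: \<pi>\<close>)
  ultimately show ?thesis by blast
qed

lemma quantum_state_spectral:
  assumes "quantum_state d \<rho>"
  shows "\<exists>U p. unitary_mat d U \<and> \<rho> = U * real_diag d p * mat_adjoint U \<and> finite_dist d p"
proof -
  have \<rho>: "psd_mat d \<rho>" "mat_trace \<rho> = 1" "\<rho> \<in> carrier_mat d d" "mat_adjoint \<rho> = \<rho>"
    using assms by (auto simp: quantum_state_def psd_mat_def)
  obtain U p where U: "unitary_mat d U" and \<rho>U: "\<rho> = U * real_diag d p * mat_adjoint U"
    using hermitian_spectral[OF \<rho>(3,4)] by blast
  have "complex_of_real (\<Sum>i<d. p i) = 1"
    using \<rho>(2) unfolding \<rho>U mat_trace_conj[OF U mat_diag_dim] by simp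
  then have "(\<Sum>i<d. p i) = 1" by (simp only: of_real_eq_1_iff)
  then have "finite_dist d p"
    using psd_eigenvalue_nonneg[OF U \<rho>(1)[unfolded \<rho>U]] by unfold_locales
  then show ?thesis using U \<rho>U by blast
qed

theorem mainTheorem2:
  fixes d :: nat and \<rho> \<pi> :: "complex mat"
  assumes "quantum_state d \<rho>" and "pure_state 2 \<pi>"
  shows "optimal_rate \<rho> \<pi> = ereal (information d \<rho>) \<and>
    (\<rho> \<noteq> max_mixed d \<longrightarrow> optimal_rate \<pi> \<rho> = ereal (1 / information d \<rho>))"
proof -
  obtain U p where U: "unitary_mat d U" and \<rho>: "\<rho> = U * real_diag d p * mat_adjoint U"
    and p: "finite_dist d p"
    using quantum_state_spectral[OF assms(1)] by blast
  obtain V where V: "unitary_mat 2 V" and \<pi>: "\<pi> = V * real_diag 2 point_mass * mat_adjoint V"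
    using pure_qubit_diag[OF assms(2)] by blast
  interpret finite_dist d p by (rule p)
  have info: "information d \<rho> = negentropy"
    unfolding information_def \<rho> vn_entropy_spectral[OF U] by (simp add: negentropy_def entropy_def)
  have "negentropy > 0" if "\<rho> \<noteq> max_mixed d"
  proof (rule ccontr)
    assume "\<not> negentropy > 0"
    then have "p i = 1 / d" if "i < d" for i
      using uniform_if_entropy_maximal[OF _ that] by (simp add: negentropy_def)
    \<comment> \<open>A scalar matrix is unaffected by the diagonalising unitary, so a uniform
      spectrum already determines the state.\<close>
    then have "real_diag d p = mat_diag d (\<lambda>_. 1 / of_nat d)"
      by (intro eq_matI) (auto simp: mat_diag_def)
    then have "\<rho> = max_mixed d"
      by (simp add: \<rho> conj_const[OF U]) (simp add: mat_diag_const max_mixed_def)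
    then show False using that by simp
  qed
  then show ?thesis
    unfolding info using optimal_rate_to_pure optimal_rate_from_pure
    by (simp add: \<rho> \<pi> optimal_rate_conj[OF U V mat_diag_dim mat_diag_dim]
        optimal_rate_conj[OF V U mat_diag_dim mat_diag_dim])
qed

end
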